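(* There exists an algorithm that, for any vector $c'$ of $d'$ non-negative integers and any sparsity $k' \in \mathbb{N}_+$, outputs an optimal solution $w^\star$ of the linear program $\mathcal{D}(c',k')$ in time $O(d'(\log c'_{max} + \log k'))$, where $c'_{max} = \max_i c'_i$.
   Context: $\Delta$ is a fixed positive integer. $\mathcal{D}(c',k')$ is the LP in variables $w_0 \in \mathbb{R}$ and $w_1,\dots,w_{d'}$: minimize $w_0 k' + \sum_{i=1}^{d'} w_i$ subject to $w_0 + \sum_{j : j \ge 1,\ j \le i \le j + \Delta - 1} w_j \ge c'_i$ for all $i = 1,\dots,d'$, and $w_i \ge 0$ for all $i = 1,\dots,d'$. (It is the LP dual of: maximize $c'^T u$ subject to $\sum_i u_i = k'$, $\sum_{j=i}^{\min\{i+\Delta-1,d'\}} u_j \le 1$ for all $i$, $u \ge 0$.)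
   Formalization: The output is claimed optimal only when D(c',k') has an optimal solution (it is unbounded if k' > ⌈d'/Δ⌉); the algorithm halts in time on all inputs. The bound is O(d'(1 + log max(1,c'_max) + log k')), since the literal one is 0 or undefined when c'_max·k' ≤ 1 or c'_max = 0; d' ≥ 1. *)

theory Defs
  imports Complex_Main "HOL-Library.Monad_Syntax"
begin

section \<open>The linear program\<close>

text \<open>A point is a function \<open>w\<close> of which only the values at \<open>0, \<dots>, d\<close> matter; \<open>c\<close> is read at
  \<open>1, \<dots>, d\<close> only.\<close>

definition dual_feasible :: "nat \<Rightarrow> nat \<Rightarrow> (nat \<Rightarrow> nat) \<Rightarrow> (nat \<Rightarrow> real) \<Rightarrow> bool" where
  "dual_feasible \<Delta> d c w \<longleftrightarrow>
     (\<forall>i\<in>{1..d}. w 0 + (\<Sum>j | 1 \<le> j \<and> j \<le> i \<and> i \<le> j + \<Delta> - 1. w j) \<ge> real (c i)) \<and>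
     (\<forall>i\<in>{1..d}. w i \<ge> 0)"

definition dual_objective :: "nat \<Rightarrow> nat \<Rightarrow> (nat \<Rightarrow> real) \<Rightarrow> real" where
  "dual_objective d k w = w 0 * real k + (\<Sum>i=1..d. w i)"

definition dual_optimal :: "nat \<Rightarrow> nat \<Rightarrow> (nat \<Rightarrow> nat) \<Rightarrow> nat \<Rightarrow> (nat \<Rightarrow> real) \<Rightarrow> bool" where
  "dual_optimal \<Delta> d c k w \<longleftrightarrow>
     dual_feasible \<Delta> d c w \<and>
     (\<forall>v. dual_feasible \<Delta> d c v \<longrightarrow> dual_objective d k w \<le> dual_objective d k v)"

definition c_max :: "nat \<Rightarrow> (nat \<Rightarrow> nat) \<Rightarrow> nat" where
  "c_max d c = Max (c ` {1..d})"


section \<open>The model of computation\<close>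

text \<open>
  Algorithms are programs of a small imperative language over a word RAM: integer variables and
  integer arrays, with unit cost for every arithmetic operation, comparison and memory access.
  Unit cost is only meaningful for words of bounded size, so execution is parametrised by a bound
  \<open>M\<close>; it is stuck as soon as a computed value exceeds \<open>M\<close> in absolute value. It is also stuck on
  division by zero and on a negative array index.
\<close>

type_synonym vname = string

record state =
  vars :: "vname \<Rightarrow> int"
  arrs :: "vname \<Rightarrow> int \<Rightarrow> int"

datatype aexp =
    N int
  | V vname
  | Elem vname aexp
  | Plus aexp aexp
  | Minus aexp aexp
  | Times aexp aexp
  | Quot aexp aexp

datatype bexp =
    Less aexp aexp
  | Neg bexp
  | And bexp bexp

datatype com =
    Skip
  | Assign vname aexp
  | Store vname aexp aexp
  | Seq com com
  | Cond bexp com com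
  | While bexp com

definition word :: "int \<Rightarrow> int \<Rightarrow> int option" where
  "word M v = (if \<bar>v\<bar> \<le> M then Some v else None)"

fun aval :: "int \<Rightarrow> state \<Rightarrow> aexp \<Rightarrow> int option" where
  "aval M s (N n) = word M n"
| "aval M s (V x) = Some (vars s x)"
| "aval M s (Elem x a) = do { i \<leftarrow> aval M s a; if i < 0 then None else Some (arrs s x i) }"
| "aval M s (Plus a b) = do { m \<leftarrow> aval M s a; n \<leftarrow> aval M s b; word M (m + n) }"
| "aval M s (Minus a b) = do { m \<leftarrow> aval M s a; n \<leftarrow> aval M s b; word M (m - n) }"
| "aval M s (Times a b) = do { m \<leftarrow> aval M s a; n \<leftarrow> aval M s b; word M (m * n) }"
| "aval M s (Quot a b) =
     do { m \<leftarrow> aval M s a; n \<leftarrow> aval M s b; if n = 0 then None else word M (m div n) }"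

fun bval :: "int \<Rightarrow> state \<Rightarrow> bexp \<Rightarrow> bool option" where
  "bval M s (Less a b) = do { m \<leftarrow> aval M s a; n \<leftarrow> aval M s b; Some (m < n) }"
| "bval M s (Neg p) = do { u \<leftarrow> bval M s p; Some (\<not> u) }"
| "bval M s (And p q) = do { u \<leftarrow> bval M s p; v \<leftarrow> bval M s q; Some (u \<and> v) }"

fun acost :: "aexp \<Rightarrow> nat" where
  "acost (N n) = 1"
| "acost (V x) = 1"
| "acost (Elem x a) = 1 + acost a"
| "acost (Plus a b) = 1 + acost a + acost b"
| "acost (Minus a b) = 1 + acost a + acost b"
| "acost (Times a b) = 1 + acost a + acost b"
| "acost (Quot a b) = 1 + acost a + acost b"

fun bcost :: "bexp \<Rightarrow> nat" where
  "bcost (Less a b) = 1 + acost a + acost b"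
| "bcost (Neg p) = 1 + bcost p"
| "bcost (And p q) = 1 + bcost p + bcost q"

text \<open>\<open>exec M p s t s'\<close>: started in state \<open>s\<close>, program \<open>p\<close> halts in state \<open>s'\<close> after \<open>t\<close> steps, all
  computed values being at most \<open>M\<close> in absolute value.\<close>

inductive exec :: "int \<Rightarrow> com \<Rightarrow> state \<Rightarrow> nat \<Rightarrow> state \<Rightarrow> bool" for M :: int where
  Skip: "exec M Skip s 1 s"
| Assign: "aval M s a = Some v \<Longrightarrow>
    exec M (Assign x a) s (1 + acost a) (s\<lparr>vars := (vars s)(x := v)\<rparr>)"
| Store: "\<lbrakk>aval M s a = Some i; i \<ge> 0; aval M s b = Some v\<rbrakk> \<Longrightarrow>
    exec M (Store x a b) s (1 + acost a + acost b)
      (s\<lparr>arrs := (arrs s)(x := (arrs s x)(i := v))\<rparr>)"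
| Seq: "\<lbrakk>exec M p s t s'; exec M q s' t' s''\<rbrakk> \<Longrightarrow> exec M (Seq p q) s (t + t') s''"
| CondTrue: "\<lbrakk>bval M s b = Some True; exec M p s t s'\<rbrakk> \<Longrightarrow>
    exec M (Cond b p q) s (1 + bcost b + t) s'"
| CondFalse: "\<lbrakk>bval M s b = Some False; exec M q s t s'\<rbrakk> \<Longrightarrow>
    exec M (Cond b p q) s (1 + bcost b + t) s'"
| WhileFalse: "bval M s b = Some False \<Longrightarrow> exec M (While b p) s (1 + bcost b) s"
| WhileTrue: "\<lbrakk>bval M s b = Some True; exec M p s t s'; exec M (While b p) s' t' s''\<rbrakk> \<Longrightarrow>
    exec M (While b p) s (1 + bcost b + t + t') s''"

inductive_cases SkipE: "exec M Skip s t s'"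
inductive_cases AssignE: "exec M (Assign x a) s t s'"
inductive_cases StoreE: "exec M (Store x a b) s t s'"
inductive_cases SeqE: "exec M (Seq p q) s t s'"
inductive_cases CondE: "exec M (Cond b p q) s t s'"
inductive_cases WhileE: "exec M (While b p) s t s'"

lemma exec_deterministic:
  "exec M p s t s' \<Longrightarrow> exec M p s u s'' \<Longrightarrow> u = t \<and> s'' = s'"
proof (induction arbitrary: u s'' rule: exec.induct)
  case (Skip s)
  from Skip.prems show ?case by (rule SkipE) simp
next
  case (Assign s a v x)
  from Assign.prems show ?case by (rule AssignE) (use Assign.hyps in simp)
next
  case (Store s a i b v x)
  from Store.prems show ?case by (rule StoreE) (use Store.hyps in simp)
next
  case (Seq p s t s' q t' r)
  from Seq.prems show ?case
  proof (rule SeqE, goal_cases)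
    case (1 v s1 v')
    from Seq.IH(1)[OF 1(2)] have "v = t" "s1 = s'" by simp_all
    with 1 Seq.IH(2)[of v' s''] show ?case by simp
  qed
next
  case (CondTrue s b p t s' q)
  from CondTrue.prems show ?case
  proof (rule CondE, goal_cases)
    case (1 v)
    with CondTrue.IH[OF 1(3)] show ?case by simp
  next
    case 2
    then show ?case using CondTrue.hyps by simp
  qed
next
  case (CondFalse s b q t s' p)
  from CondFalse.prems show ?case
  proof (rule CondE, goal_cases)
    case 1
    then show ?case using CondFalse.hyps by simp
  next
    case (2 v)
    with CondFalse.IH[OF 2(3)] show ?case by simp
  qed
next
  case (WhileFalse s b p)
  from WhileFalse.prems show ?case
    by (rule WhileE) (use WhileFalse.hyps in simp_all)
next
  case (WhileTrue s b p t s' t' r)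
  from WhileTrue.prems show ?case
  proof (rule WhileE, goal_cases)
    case 1
    then show ?case using WhileTrue.hyps by simp
  next
    case (2 v s1 v')
    from WhileTrue.IH(1)[OF 2(3)] have "v = t" "s1 = s'" by simp_all
    with 2 WhileTrue.IH(2)[of v' s''] show ?case by simp
  qed
qed


section \<open>Input and output\<close>

text \<open>All memory that does not hold the input is initially \<open>0\<close>.\<close>

definition input_state :: "nat \<Rightarrow> nat \<Rightarrow> nat \<Rightarrow> (nat \<Rightarrow> nat) \<Rightarrow> state" where
  "input_state \<Delta> d k c =
     \<lparr>vars = (\<lambda>_. 0)(''Delta'' := int \<Delta>, ''d'' := int d, ''k'' := int k),
      arrs = (\<lambda>_ _. 0)(''c'' := (\<lambda>i. if 1 \<le> i \<and> i \<le> int d then int (c (nat i)) else 0))\<rparr>"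

text \<open>The solution \<open>(w\<^sub>0, \<dots>, w\<^sub>d)\<close> is read from the array \<open>w\<close>.\<close>

definition output_point :: "state \<Rightarrow> nat \<Rightarrow> real" where
  "output_point s i = real_of_int (arrs s ''w'' (int i))"

text \<open>Words have \<open>e \<cdot> log (d + k + c_max + \<Delta>)\<close> bits (up to sign), i.e. a constant multiple of the
  bit length of the input numbers and addresses.\<close>

definition word_bound :: "nat \<Rightarrow> nat \<Rightarrow> nat \<Rightarrow> nat \<Rightarrow> (nat \<Rightarrow> nat) \<Rightarrow> int" where
  "word_bound e \<Delta> d k c = int ((d + k + c_max d c + \<Delta>) ^ e)"

text \<open>The summand \<open>1\<close> and the \<open>max 1\<close> only matter where \<open>log c_max + log k\<close> is undefined or \<open>0\<close>, i.e.
  for \<open>c_max \<cdot> k \<le> 1\<close>; for \<open>c_max \<cdot> k \<ge> 2\<close> this is at most \<open>2 \<cdot> d \<cdot> (log c_max + log k)\<close>.\<close>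

definition time_bound :: "nat \<Rightarrow> nat \<Rightarrow> (nat \<Rightarrow> nat) \<Rightarrow> real" where
  "time_bound d k c = real d * (1 + log 2 (real (max 1 (c_max d c))) + log 2 (real k))"

end

theory Submission
  imports Defs
begin

text \<open>
  For fixed \<open>w\<^sub>0 = l\<close> the program decouples into a covering problem, solved by the recursion
  \<open>X\<^sub>i = max X\<^sub>i\<^sub>-\<^sub>1 (c\<^sub>i - l + X\<^sub>i\<^sub>-\<^sub>\<Delta>)\<close> for the partial sums of \<open>w\<close>. Its value \<open>X\<^sub>d\<close> is the maximum of
  \<open>V n - l n\<close> over \<open>n\<close>, where \<open>V n\<close> is the largest \<open>c\<close>-weight of \<open>n\<close> indices that are pairwise at
  least \<open>\<Delta>\<close> apart. So one has to minimise \<open>f l = k l + X\<^sub>d l\<close>.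

  The function \<open>V\<close> is concave: the counting functions \<open>A\<close>, \<open>B\<close> of index sets of sizes \<open>n\<close> and
  \<open>n + 2\<close> can be replaced by \<open>max A (B - 1)\<close> and \<open>min (A + 1) B\<close>, both of size \<open>n + 1\<close>. As \<open>V\<close> is
  integral, an integer \<open>l\<close> with \<open>f l \<le> f (l \<plusminus> 1)\<close> lies between \<open>V (k + 1) - V k\<close> and
  \<open>V k - V (k - 1)\<close>; then \<open>f l = V k\<close>, which is a lower bound by weak duality. These differences are
  at least \<open>- k c_max\<close> and at most \<open>c_max\<close>, so bisection finds \<open>l\<close> in \<open>O(log c_max + log k)\<close>
  evaluations of \<open>f\<close>, each of cost \<open>O(d)\<close>. If no \<open>k\<close> indices are pairwise \<open>\<Delta>\<close> apart, then \<open>f\<close>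
  tends to \<open>-\<infinity>\<close> for \<open>l \<rightarrow> -\<infinity>\<close> and there is no optimal solution.
\<close>

section \<open>The linear program as a one-dimensional problem\<close>

text \<open>A profile counts, for every \<open>i\<close>, the elements up to \<open>i\<close> of a set of positive indices any two
  of which are at least \<open>\<Delta>\<close> apart, i.e. of an integral solution of the primal program.\<close>

definition profile :: "nat \<Rightarrow> (nat \<Rightarrow> int) \<Rightarrow> bool" where
  "profile \<Delta> U \<longleftrightarrow> U 0 = 0 \<and> (\<forall>i. U i \<le> U (Suc i)) \<and> (\<forall>i. U i \<le> U (i - \<Delta>) + 1)"

definition gain :: "nat \<Rightarrow> (nat \<Rightarrow> nat) \<Rightarrow> (nat \<Rightarrow> int) \<Rightarrow> int" where
  "gain d c U = (\<Sum>i=1..d. int (c i) * (U i - U (i - 1)))"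

lemma profile_mono: "profile \<Delta> U \<Longrightarrow> i \<le> j \<Longrightarrow> U i \<le> U j"
  unfolding profile_def by (metis lift_Suc_mono_le)

lemma profile_nonneg: "profile \<Delta> U \<Longrightarrow> 0 \<le> U i"
  using profile_mono[of \<Delta> U 0 i] by (simp add: profile_def)

text \<open>The primal constraint for the window of \<open>\<Delta>\<close> indices that starts at
  \<open>j\<close>.\<close>

lemma profile_window:
  assumes "profile \<Delta> U" "1 \<le> j"
  shows "U (j + \<Delta> - 1) - U (j - 1) \<le> 1"
proof -
  have "U (j + \<Delta> - 1) \<le> U (j + \<Delta> - 1 - \<Delta>) + 1"
    using assms(1) unfolding profile_def by blast
  moreover have "j + \<Delta> - 1 - \<Delta> = j - 1" by simp
  ultimately show ?thesis by simp
qed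

lemma profile_diff_nonneg: "profile \<Delta> U \<Longrightarrow> 0 \<le> U i - U (i - 1)"
  using profile_mono[of \<Delta> U "i - 1" i] by simp

lemma profile_total: "profile \<Delta> U \<Longrightarrow> (\<Sum>i=1..d. U i - U (i - 1)) = U d"
  using sum_telescope''[of 0 d U] by (simp add: profile_def)

text \<open>Keeps only the first \<open>n\<close> elements of the set that \<open>U\<close>
  counts.\<close>

lemma profile_truncate:
  assumes "profile \<Delta> U" "0 \<le> n"
  shows "profile \<Delta> (\<lambda>i. min (U i) n)"
  using assms unfolding profile_def by (auto simp: min_def) (smt (verit))+

text \<open>Monotonicity and the window condition survive pointwise maxima, minima and added
  constants. The shifts by 1 are harmless at index 0, where the values are max 0 (-1) and min 1
  0.\<close>

lemma profile_exchange:
  assumes "profile \<Delta> A" "profile \<Delta> B"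
  shows "profile \<Delta> (\<lambda>i. max (A i) (B i - 1))" "profile \<Delta> (\<lambda>i. min (A i + 1) (B i))"
  using assms unfolding profile_def by (auto simp: min_def max_def) (smt (verit))+

text \<open>\<open>gain\<close> is linear in the counting function, and the exchange preserves the
  pointwise sum, because min (x + 1) y = min x (y - 1) + 1.\<close>

lemma gain_exchange:
  "gain d c (\<lambda>i. max (A i) (B i - 1)) + gain d c (\<lambda>i. min (A i + 1) (B i)) = gain d c A + gain d c B"
proof -
  have *: "max x (y - 1) + min (x + 1) y = x + y" for x y :: int by simp
  have "int (c i) * (max (A i) (B i - 1) - max (A j) (B j - 1)) +
        int (c i) * (min (A i + 1) (B i) - min (A j + 1) (B j)) =
        int (c i) * (A i - A j) + int (c i) * (B i - B j)" for i j
    using *[of "A i" "B i"] *[of "A j" "B j"]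
    by (simp add: distrib_left[symmetric])
  then show ?thesis unfolding gain_def sum.distrib[symmetric] by simp
qed

lemma gain_nonneg: "profile \<Delta> U \<Longrightarrow> 0 \<le> gain d c U"
  unfolding gain_def by (intro sum_nonneg mult_nonneg_nonneg) (auto dest: profile_diff_nonneg)

lemma c_le_c_max: "i \<in> {1..d} \<Longrightarrow> c i \<le> c_max d c"
  unfolding c_max_def by (intro Max_ge) auto

lemma gain_le:
  assumes "profile \<Delta> U"
  shows "gain d c U \<le> U d * int (c_max d c)"
proof -
  have "gain d c U \<le> (\<Sum>i=1..d. int (c_max d c) * (U i - U (i - 1)))"
    unfolding gain_def using profile_diff_nonneg[OF assms] c_le_c_max[of _ d c]
    by (intro sum_mono mult_right_mono) auto
  then show ?thesis by (simp add: sum_distrib_left[symmetric] profile_total[OF assms, simplified] mult.commute)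
qed

section \<open>Weak duality\<close>

text \<open>Multiply the \<open>i\<close>-th constraint by the \<open>i\<close>-th increment of
  \<open>U\<close>, add up and exchange the summations: the coefficient of \<open>v j\<close>
  becomes the count in the window starting at \<open>j\<close>, at most 1. The size
  \<open>U d\<close> is left open, since sizes other than \<open>k\<close> are compared
  later.\<close>

lemma gain_le_objective:
  assumes U: "profile \<Delta> U" and v: "dual_feasible \<Delta> d c v" and "1 \<le> \<Delta>"
  shows "real_of_int (gain d c U) \<le> real_of_int (U d) * v 0 + (\<Sum>i=1..d. v i)"
proof -
  define u where "u i = real_of_int (U i - U (i - 1))" for i
  have u0: "0 \<le> u i" for i
    using profile_diff_nonneg[OF U, of i] by (simp add: u_def)
  have vj: "0 \<le> v j" if "j \<in> {1..d}" for j
    using v that by (auto simp: dual_feasible_def)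
  have "real_of_int (gain d c U) = (\<Sum>i=1..d. real (c i) * u i)"
    by (simp add: gain_def u_def)
  also have "\<dots> \<le> (\<Sum>i=1..d. (v 0 + (\<Sum>j | 1 \<le> j \<and> j \<le> i \<and> i \<le> j + \<Delta> - 1. v j)) * u i)"
    using v u0 by (intro sum_mono mult_right_mono) (auto simp: dual_feasible_def)
  also have "\<dots> = v 0 * (\<Sum>i=1..d. u i) +
      (\<Sum>i=1..d. \<Sum>j | j \<in> {1..d} \<and> j \<le> i \<and> i \<le> j + \<Delta> - 1. v j * u i)"
  proof -
    \<comment> \<open>Here \<open>j \<le> i \<le> d\<close>, so \<open>j\<close> can be confined to
      a range independent of \<open>i\<close>, as the exchange of summations requires.\<close>
    have "{j. 1 \<le> j \<and> j \<le> i \<and> i \<le> j + \<Delta> - 1} = {j. j \<in> {1..d} \<and> j \<le> i \<and> i \<le> j + \<Delta> - 1}"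
      if "i \<in> {1..d}" for i
      using that by auto
    then have "(\<Sum>i=1..d. \<Sum>j | 1 \<le> j \<and> j \<le> i \<and> i \<le> j + \<Delta> - 1. v j * u i) =
        (\<Sum>i=1..d. \<Sum>j | j \<in> {1..d} \<and> j \<le> i \<and> i \<le> j + \<Delta> - 1. v j * u i)"
      by (intro sum.cong) auto
    then show ?thesis
      by (simp only: distrib_right sum.distrib sum_distrib_left sum_distrib_right)
  qed
  also have "(\<Sum>i=1..d. u i) = U d"
    unfolding u_def of_int_sum[symmetric] profile_total[OF U] ..
  also have "(\<Sum>i=1..d. \<Sum>j | j \<in> {1..d} \<and> j \<le> i \<and> i \<le> j + \<Delta> - 1. v j * u i)
     = (\<Sum>j=1..d. \<Sum>i | i \<in> {1..d} \<and> j \<le> i \<and> i \<le> j + \<Delta> - 1. v j * u i)"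
    by (rule sum.swap_restrict) auto
  also have "\<dots> \<le> (\<Sum>j=1..d. v j)"
  proof (rule sum_mono)
    fix j assume j: "j \<in> {1..d}"
    \<comment> \<open>The window starting at \<open>j\<close> may reach beyond \<open>d\<close> and
      is cut off there.\<close>
    define e where "e = min d (j + \<Delta> - 1)"
    have set: "{i. i \<in> {1..d} \<and> j \<le> i \<and> i \<le> j + \<Delta> - 1} = {Suc (j - 1)..e}"
      using j by (auto simp: e_def)
    have "j - 1 \<le> e" using j by (auto simp: e_def)
    then have "(\<Sum>i\<in>{Suc (j - 1)..e}. U i - U (i - 1)) = U e - U (j - 1)"
      by (rule sum_telescope'')
    also have "\<dots> \<le> U (j + \<Delta> - 1) - U (j - 1)"
      using profile_mono[OF U] by (simp add: e_def)
    also have "\<dots> \<le> 1" using profile_window[OF U] j by simp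
    finally have "(\<Sum>i\<in>{Suc (j - 1)..e}. u i) \<le> 1"
      unfolding u_def of_int_sum[symmetric] by linarith
    then show "(\<Sum>i | i \<in> {1..d} \<and> j \<le> i \<and> i \<le> j + \<Delta> - 1. v j * u i) \<le> v j"
      unfolding set sum_distrib_left[symmetric] using vj[OF j] by (simp add: mult_left_le)
  qed
  finally show ?thesis by (simp add: mult.commute)
qed

section \<open>The greedy solution for fixed \<open>l\<close>\<close>

text \<open>\<open>cover \<Delta> c l i\<close> is the partial sum \<open>w\<^sub>1 + \<dots> + w\<^sub>i\<close> of the greedy solution for fixed \<open>w\<^sub>0 = l\<close>, which
  puts the weight a constraint still lacks on its last variable. The index \<open>i - (\<Delta> - 1)\<close> is
  \<open>Suc i - \<Delta>\<close>, in a form that terminates for \<open>\<Delta> = 0\<close> as well.\<close>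

function cover :: "nat \<Rightarrow> (nat \<Rightarrow> nat) \<Rightarrow> int \<Rightarrow> nat \<Rightarrow> int" where
  "cover \<Delta> c l 0 = 0"
| "cover \<Delta> c l (Suc i) = max (cover \<Delta> c l i) (int (c (Suc i)) - l + cover \<Delta> c l (i - (\<Delta> - 1)))"
  by pat_completeness auto
termination by (relation "measure (\<lambda>(_, _, _, i). i)") auto

definition cover_point :: "nat \<Rightarrow> (nat \<Rightarrow> nat) \<Rightarrow> int \<Rightarrow> nat \<Rightarrow> real" where
  "cover_point \<Delta> c l i =
     (if i = 0 then real_of_int l else real_of_int (cover \<Delta> c l i - cover \<Delta> c l (i - 1)))"

lemma cover_mono: "i \<le> j \<Longrightarrow> cover \<Delta> c l i \<le> cover \<Delta> c l j"
  by (rule lift_Suc_mono_le) auto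

lemma cover_nonneg: "0 \<le> cover \<Delta> c l i"
  using cover_mono[of 0 i] by simp

text \<open>Each step adds at most \<open>W\<close>, because the earlier value in the recursion is
  at most the preceding one by monotonicity.\<close>

lemma cover_le:
  assumes "\<And>j. j \<in> {1..i} \<Longrightarrow> int (c j) - l \<le> W" "0 \<le> W"
  shows "cover \<Delta> c l i \<le> int i * W"
  using assms(1)
proof (induction i)
  case (Suc i)
  have "cover \<Delta> c l (i - (\<Delta> - 1)) \<le> cover \<Delta> c l i" by (rule cover_mono) simp
  moreover have "cover \<Delta> c l i \<le> int i * W" using Suc by simp
  moreover have "int (c (Suc i)) - l \<le> W" using Suc.prems by simp
  ultimately show ?case using \<open>0 \<le> W\<close> by (simp add: distrib_right)
qed simp

lemma sum_cover_point:
  assumes "m \<le> n"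
  shows "(\<Sum>i=Suc m..n. cover_point \<Delta> c l i) = real_of_int (cover \<Delta> c l n - cover \<Delta> c l m)"
proof -
  have "(\<Sum>i=Suc m..n. cover_point \<Delta> c l i) =
      real_of_int (\<Sum>i=Suc m..n. cover \<Delta> c l i - cover \<Delta> c l (i - 1))"
    unfolding of_int_sum by (intro sum.cong) (auto simp: cover_point_def)
  then show ?thesis by (simp only: sum_telescope''[OF assms, of "cover \<Delta> c l"])
qed

lemma cover_point_objective:
  "dual_objective d k (cover_point \<Delta> c l) = real_of_int (int k * l + cover \<Delta> c l d)"
  using sum_cover_point[of 0 d \<Delta> c l] by (simp add: dual_objective_def cover_point_def)

text \<open>A window sum of the increments telescopes to a difference of two \<open>cover\<close>
  values; the second argument of the maximum in the recursion is exactly the constraint.\<close>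

lemma cover_point_feasible:
  assumes "1 \<le> \<Delta>"
  shows "dual_feasible \<Delta> d c (cover_point \<Delta> c l)"
  unfolding dual_feasible_def
proof (intro conjI ballI)
  fix i assume "i \<in> {1..d}"
  then obtain n where n: "i = Suc n" by (cases i) auto
  have set: "{j. 1 \<le> j \<and> j \<le> i \<and> i \<le> j + \<Delta> - 1} = {Suc (n - (\<Delta> - 1))..i}"
    using assms by (auto simp: n)
  have "n - (\<Delta> - 1) \<le> i" by (simp add: n)
  note sum = sum_cover_point[OF this, of \<Delta> c l]
  show "cover_point \<Delta> c l 0 + (\<Sum>j | 1 \<le> j \<and> j \<le> i \<and> i \<le> j + \<Delta> - 1. cover_point \<Delta> c l j) \<ge> real (c i)"
    unfolding set sum by (simp add: n cover_point_def)
next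
  fix i
  show "0 \<le> cover_point \<Delta> c l i" if "i \<in> {1..d}"
    using that cover_mono[of "i - 1" i \<Delta> c l] by (simp add: cover_point_def)
qed

text \<open>Traces the recursion back: if the maximum is not the preceding value, \<open>i\<close>
  is added to the index set belonging to the earlier argument. Constancy from \<open>i\<close> on
  says that the set has no elements beyond \<open>i\<close>, which keeps the added index far enough
  from the others.\<close>

lemma cover_attained:
  assumes "1 \<le> \<Delta>"
  shows "\<exists>U. profile \<Delta> U \<and> (\<forall>j\<ge>i. U j = U i) \<and> cover \<Delta> c l i = gain i c U - l * U i"
proof (induction i rule: less_induct)
  case (less i)
  show ?case
  proof (cases i)
    case 0
    then show ?thesis by (intro exI[of _ "\<lambda>_. 0"]) (simp add: profile_def gain_def)
  next
    case (Suc n)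
    show ?thesis
    proof (cases "cover \<Delta> c l i = cover \<Delta> c l n")
      case True
      from less[of n] Suc obtain U where
        U: "profile \<Delta> U" and const: "\<forall>j\<ge>n. U j = U n"
        and val: "cover \<Delta> c l n = gain n c U - l * U n" by blast
      have i: "U i = U n" by (rule const[rule_format]) (simp add: Suc)
      have "gain i c U = gain n c U + int (c i) * (U i - U n)" by (simp add: gain_def Suc)
      then have "cover \<Delta> c l i = gain i c U - l * U i" using val True i by simp
      moreover have "\<forall>j\<ge>i. U j = U i" 
      proof (intro allI impI)
        fix j assume "i \<le> j"
        then have "U j = U n" by (intro const[rule_format]) (simp add: Suc)
        then show "U j = U i" using i by simp
      qed
      ultimately show ?thesis using U by blast
    next
      case False
      \<comment> \<open>This is \<open>i - \<Delta>\<close>, the last index that may precede an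
        element at \<open>i\<close>.\<close>
      define m where "m = n - (\<Delta> - 1)"
      have m: "m < i" "m \<le> n" by (auto simp: m_def Suc)
      from less[OF m(1)] obtain U where
        U: "profile \<Delta> U" and const': "\<forall>j\<ge>m. U j = U m"
        and val: "cover \<Delta> c l m = gain m c U - l * U m" by blast
      have const: "U j = U m" if "m \<le> j" for j using const' that by blast
      define U' where "U' j = (if i \<le> j then U j + 1 else U j)" for j
      have "profile \<Delta> U'"
        unfolding profile_def
      proof (intro conjI allI)
        show "U' 0 = 0" using U Suc by (simp add: U'_def profile_def)
        show "U' j \<le> U' (Suc j)" for j using profile_mono[OF U, of j "Suc j"] by (simp add: U'_def)
        show "U' j \<le> U' (j - \<Delta>) + 1" for j
        proof (cases "i \<le> j")
          case True
          have "m \<le> j - \<Delta>" using True \<open>1 \<le> \<Delta>\<close> by (auto simp: m_def Suc)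
          then show ?thesis using const[of j] const[of "j - \<Delta>"] m True by (simp add: U'_def)
        next
          case False
          then have "\<not> i \<le> j - \<Delta>" by simp
          moreover have "U j \<le> U (j - \<Delta>) + 1" using U unfolding profile_def by blast
          ultimately show ?thesis using False by (simp add: U'_def)
        qed
      qed
      moreover have "\<forall>j\<ge>i. U' j = U' i"
      proof (intro allI impI)
        fix j assume "i \<le> j"
        then show "U' j = U' i" using const[of j] const[of i] m by (simp add: U'_def)
      qed
      moreover have "cover \<Delta> c l i = gain i c U' - l * U' i"
      proof -
        have "(\<Sum>j=Suc m..n. int (c j) * (U' j - U' (j - 1))) = 0"
        proof (rule sum.neutral, rule ballI)
          fix j assume j: "j \<in> {Suc m..n}"
          then have "U j = U m" "U (j - 1) = U m" by (auto intro: const)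
          then show "int (c j) * (U' j - U' (j - 1)) = 0" using j by (auto simp: U'_def Suc)
        qed
        moreover have "gain m c U' = gain m c U"
          unfolding gain_def using m by (intro sum.cong) (auto simp: U'_def)
        moreover have "gain n c U' = gain m c U' + (\<Sum>j=Suc m..n. int (c j) * (U' j - U' (j - 1)))"
          unfolding gain_def using sum.ub_add_nat[of 1 m "\<lambda>j. int (c j) * (U' j - U' (j - 1))" "n - m"] m
          by simp
        moreover have "gain i c U' = gain n c U' + int (c i) * (U' i - U' n)"
          by (simp add: gain_def Suc)
        moreover have "U i = U m" "U n = U m" using m by (auto intro: const)
        moreover have "cover \<Delta> c l i = int (c i) - l + cover \<Delta> c l m"
          using False by (simp add: Suc m_def max_def split: if_splits)
        ultimately show ?thesis using val by (simp add: U'_def Suc algebra_simps)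
      qed
      ultimately show ?thesis by blast
    qed
  qed
qed

text \<open>Weak duality applied to the greedy solution. With \<open>cover_attained\<close>, its
  value is the maximum of gain minus \<open>l\<close> times size.\<close>

lemma cover_ge:
  assumes "1 \<le> \<Delta>" "profile \<Delta> U"
  shows "gain d c U - l * U d \<le> cover \<Delta> c l d"
proof -
  have "real_of_int (gain d c U) \<le> real_of_int (U d) * l + cover \<Delta> c l d"
    using gain_le_objective[OF assms(2) cover_point_feasible[OF assms(1)] assms(1), of d c l]
      sum_cover_point[of 0 d \<Delta> c l] by (simp add: cover_point_def)
  then show ?thesis by (simp flip: of_int_mult of_int_add add: mult.commute)
qed

text \<open>Otherwise, by truncation, all profiles have size below \<open>k\<close>. The greedy
  objective is then a gain plus a positive multiple of \<open>l\<close>, hence unbounded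
  below.\<close>

lemma profile_of_optimal:
  assumes "1 \<le> \<Delta>" and opt: "dual_optimal \<Delta> d c k w"
  shows "\<exists>U. profile \<Delta> U \<and> U d = int k"
proof (rule ccontr)
  assume none: "\<not> ?thesis"
  have lt: "U d < int k" if "profile \<Delta> U" for U
  proof (rule ccontr)
    assume "\<not> U d < int k"
    then have "profile \<Delta> (\<lambda>i. min (U i) (int k))" "min (U d) (int k) = int k"
      using profile_truncate[OF that, of "int k"] by auto
    with none show False by blast
  qed
  define z where "z = dual_objective d k w"
  \<comment> \<open>Since \<open>l \<le> 0\<close> and \<open>k - U d \<ge> 1\<close>, the objective
    is at most \<open>k c_max + l\<close>, which this choice pushes below the floor of
    \<open>z\<close>.\<close>
  define l where "l = min 0 (\<lfloor>z\<rfloor> - int k * int (c_max d c) - 1)"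
  obtain U where U: "profile \<Delta> U" "cover \<Delta> c l d = gain d c U - l * U d"
    using cover_attained[OF assms(1)] by blast
  have "gain d c U \<le> int k * int (c_max d c)"
    using gain_le[OF U(1), of d c] lt[OF U(1)] mult_right_mono[of "U d" "int k" "int (c_max d c)"]
    by linarith
  moreover have "(int k - U d) * l \<le> 1 * l"
    using lt[OF U(1)] by (intro mult_right_mono_neg) (auto simp: l_def)
  ultimately have "int k * l + cover \<Delta> c l d < \<lfloor>z\<rfloor>"
    unfolding U(2) by (simp add: algebra_simps l_def)
  then have "dual_objective d k (cover_point \<Delta> c l) < z"
    unfolding cover_point_objective by linarith
  with opt cover_point_feasible[OF assms(1), of d c l] show False
    by (force simp: dual_optimal_def z_def)
qed

section \<open>Concavity of the largest gain as a function of the size\<close>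

definition size_attainable :: "nat \<Rightarrow> nat \<Rightarrow> nat \<Rightarrow> bool" where
  "size_attainable \<Delta> d n \<longleftrightarrow> (\<exists>U. profile \<Delta> U \<and> U d = int n)"

text \<open>Meaningless, being the maximum of the empty set, unless \<open>size_attainable \<Delta> d n\<close>.\<close>

definition best_gain :: "nat \<Rightarrow> nat \<Rightarrow> (nat \<Rightarrow> nat) \<Rightarrow> nat \<Rightarrow> int" where
  "best_gain \<Delta> d c n = Max {gain d c U |U. profile \<Delta> U \<and> U d = int n}"

lemma finite_gains: "finite {gain d c U |U. profile \<Delta> U \<and> U d = int n}"
proof (rule finite_subset)
  show "{gain d c U |U. profile \<Delta> U \<and> U d = int n} \<subseteq> {0..int n * int (c_max d c)}"
    using gain_le[of \<Delta> _ d c] gain_nonneg[of \<Delta> _ d c] by fastforce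
qed simp

lemma best_gain_ge: "profile \<Delta> U \<Longrightarrow> U d = int n \<Longrightarrow> gain d c U \<le> best_gain \<Delta> d c n"
  unfolding best_gain_def by (rule Max_ge[OF finite_gains]) auto

lemma best_gain_attained:
  assumes "size_attainable \<Delta> d n"
  obtains U' where "profile \<Delta> U'" "U' d = int n" "gain d c U' = best_gain \<Delta> d c n"
proof -
  have "best_gain \<Delta> d c n \<in> {gain d c U |U. profile \<Delta> U \<and> U d = int n}"
    unfolding best_gain_def using assms by (intro Max_in[OF finite_gains]) (auto simp: size_attainable_def)
  then show ?thesis using that by auto
qed

lemma size_attainable_antimono:
  assumes "size_attainable \<Delta> d n" "m \<le> n"
  shows "size_attainable \<Delta> d m"
proof -
  obtain U where "profile \<Delta> U" "U d = int n" using assms by (auto simp: size_attainable_def)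
  then have "profile \<Delta> (\<lambda>i. min (U i) (int m))" "min (U d) (int m) = int m"
    using assms(2) profile_truncate[of \<Delta> U "int m"] by auto
  then show ?thesis unfolding size_attainable_def by (intro exI conjI)
qed

text \<open>Exchanging best profiles of sizes \<open>n\<close> and \<open>n + 2\<close> gives two of
  size \<open>n + 1\<close> with the same total gain.\<close>

lemma best_gain_concave:
  assumes "size_attainable \<Delta> d (Suc (Suc n))"
  shows "best_gain \<Delta> d c (Suc (Suc n)) - best_gain \<Delta> d c (Suc n)
       \<le> best_gain \<Delta> d c (Suc n) - best_gain \<Delta> d c n"
proof -
  have "size_attainable \<Delta> d n" using size_attainable_antimono[OF assms] by simp
  then obtain A where A: "profile \<Delta> A" "A d = int n" "gain d c A = best_gain \<Delta> d c n"
    by (rule best_gain_attained)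
  obtain B where B: "profile \<Delta> B" "B d = int (Suc (Suc n))"
      "gain d c B = best_gain \<Delta> d c (Suc (Suc n))"
    using assms by (rule best_gain_attained)
  have "gain d c (\<lambda>i. max (A i) (B i - 1)) \<le> best_gain \<Delta> d c (Suc n)"
    by (rule best_gain_ge[OF profile_exchange(1)[OF A(1) B(1)]]) (simp add: A B)
  moreover have "gain d c (\<lambda>i. min (A i + 1) (B i)) \<le> best_gain \<Delta> d c (Suc n)"
    by (rule best_gain_ge[OF profile_exchange(2)[OF A(1) B(1)]]) (simp add: A B)
  ultimately show ?thesis using gain_exchange[of d c A B] A B by linarith
qed

lemma best_gain_diff_antimono:
  assumes "size_attainable \<Delta> d (Suc n)" "m \<le> n"
  shows "best_gain \<Delta> d c (Suc n) - best_gain \<Delta> d c n \<le> best_gain \<Delta> d c (Suc m) - best_gain \<Delta> d c m"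
  using assms(2,1)
proof (induction n rule: dec_induct)
  case (step n)
  then show ?case
    using best_gain_concave[of \<Delta> d n c] size_attainable_antimono[of \<Delta> d "Suc (Suc n)" "Suc n"]
    by linarith
qed simp

text \<open>By concavity, a slope at most \<open>l\<close> at \<open>m\<close> stays at most
  \<open>l\<close> to the right, so subtracting the line of slope \<open>l\<close> leaves a function
  that does not increase from \<open>m\<close> on. \<open>best_gain_le_left\<close> is the mirror
  image.\<close>

lemma best_gain_le_right:
  assumes "best_gain \<Delta> d c (Suc m) - best_gain \<Delta> d c m \<le> l"
    and "size_attainable \<Delta> d n" "m \<le> n"
  shows "best_gain \<Delta> d c n - l * int n \<le> best_gain \<Delta> d c m - l * int m"
  using assms(3,2)
proof (induction n rule: dec_induct)
  case (step n)
  then show ?case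
    using best_gain_diff_antimono[of \<Delta> d n m c] assms(1)
      size_attainable_antimono[of \<Delta> d "Suc n" n]
    by (simp add: algebra_simps)
qed simp

lemma best_gain_le_left:
  assumes "l \<le> best_gain \<Delta> d c (Suc m) - best_gain \<Delta> d c m"
    and "size_attainable \<Delta> d (Suc m)" "n \<le> Suc m"
  shows "best_gain \<Delta> d c n - l * int n \<le> best_gain \<Delta> d c (Suc m) - l * int (Suc m)"
  using assms(3)
proof (induction n rule: inc_induct)
  case (step n)
  then show ?case
    using best_gain_diff_antimono[OF assms(2), of n c] assms(1)
    by (simp add: algebra_simps)
qed simp

lemma cover_ge_best_gain:
  assumes "1 \<le> \<Delta>" "size_attainable \<Delta> d n"
  shows "best_gain \<Delta> d c n - l * int n \<le> cover \<Delta> c l d"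
proof -
  obtain U where "profile \<Delta> U" "U d = int n" "gain d c U = best_gain \<Delta> d c n"
    using assms(2) by (rule best_gain_attained)
  then show ?thesis using cover_ge[OF assms(1), of U d c l] by simp
qed

text \<open>Groups profiles by size. With \<open>cover_ge_best_gain\<close>, this makes
  \<open>cover\<close>, as a function of \<open>l\<close>, the convex conjugate of the negative of
  \<open>best_gain\<close>, evaluated at \<open>- l\<close>.\<close>

lemma cover_eq_best_gain:
  assumes "1 \<le> \<Delta>"
  obtains n where "size_attainable \<Delta> d n" "cover \<Delta> c l d = best_gain \<Delta> d c n - l * int n"
proof -
  obtain U where U: "profile \<Delta> U" "cover \<Delta> c l d = gain d c U - l * U d"
    using cover_attained[OF assms] by blast
  have n: "U d = int (nat (U d))" using profile_nonneg[OF U(1)] by simp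
  then have s: "size_attainable \<Delta> d (nat (U d))" using U by (auto simp: size_attainable_def)
  moreover have "cover \<Delta> c l d = best_gain \<Delta> d c (nat (U d)) - l * int (nat (U d))"
    using best_gain_ge[OF U(1) n, of c] cover_ge_best_gain[OF assms s, of c l] U(2) n by simp
  ultimately show ?thesis by (rule that)
qed

text \<open>The first difference is the largest by concavity. For \<open>l = c_max\<close> no
  constraint lacks anything, so the greedy value is 0 and one index gains at most
  \<open>c_max\<close>.\<close>

lemma best_gain_diff_le:
  assumes "1 \<le> \<Delta>" "size_attainable \<Delta> d (Suc n)"
  shows "best_gain \<Delta> d c (Suc n) - best_gain \<Delta> d c n \<le> int (c_max d c)"
proof -
  have z: "cover \<Delta> c (int (c_max d c)) d \<le> 0"
    using cover_le[of d c "int (c_max d c)" 0 \<Delta>] c_le_c_max[of _ d c] by simp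
  have "best_gain \<Delta> d c (Suc 0) - int (c_max d c) * int (Suc 0) \<le> 0"
    using cover_ge_best_gain[OF assms(1) size_attainable_antimono[OF assms(2), of "Suc 0"], of c "int (c_max d c)"] z
    by simp
  moreover have "0 \<le> best_gain \<Delta> d c 0"
    using best_gain_ge[of \<Delta> "\<lambda>_. 0" d 0 c] by (simp add: profile_def gain_def)
  ultimately show ?thesis using best_gain_diff_antimono[OF assms(2), of 0 c] by simp
qed

lemma best_gain_diff_ge:
  assumes "size_attainable \<Delta> d (Suc n)"
  shows "- (int n * int (c_max d c)) \<le> best_gain \<Delta> d c (Suc n) - best_gain \<Delta> d c n"
proof -
  have "size_attainable \<Delta> d n" using size_attainable_antimono[OF assms] by simp
  then obtain A where A: "profile \<Delta> A" "A d = int n" "gain d c A = best_gain \<Delta> d c n"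
    by (rule best_gain_attained)
  obtain B where B: "profile \<Delta> B" "B d = int (Suc n)" "gain d c B = best_gain \<Delta> d c (Suc n)"
    using assms by (rule best_gain_attained)
  show ?thesis using gain_le[OF A(1), of d c] gain_nonneg[OF B(1), of d c] A B by simp
qed

section \<open>Optimality of an integer no worse than its neighbours\<close>

text \<open>The comparisons with the neighbours force \<open>l\<close> between the slopes of
  \<open>best_gain\<close> on both sides of \<open>k\<close>, so size \<open>k\<close> is the best
  one for \<open>l\<close>. At the ends of the search interval, the bounds on the differences of
  \<open>best_gain\<close> replace the comparison.\<close>

lemma local_min_optimal:
  assumes \<Delta>: "1 \<le> \<Delta>" and "1 \<le> k" and opt: "dual_optimal \<Delta> d c k w"
    and left: "l = - (int k * int (c_max d c)) \<or>
      int k * l + cover \<Delta> c l d \<le> int k * (l - 1) + cover \<Delta> c (l - 1) d"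
    and right: "l = int (c_max d c) \<or>
      int k * l + cover \<Delta> c l d \<le> int k * (l + 1) + cover \<Delta> c (l + 1) d"
  shows "dual_optimal \<Delta> d c k (cover_point \<Delta> c l)"
proof -
  let ?V = "best_gain \<Delta> d c"
  obtain r where r: "k = Suc r" using \<open>1 \<le> k\<close> by (cases k) auto
  have k: "size_attainable \<Delta> d (Suc r)"
    using profile_of_optimal[OF \<Delta> opt] by (simp add: size_attainable_def r)
  have lower: "l \<le> ?V (Suc r) - ?V r"
  proof (cases "l = - (int k * int (c_max d c))")
    case True
    have "int r * int (c_max d c) \<le> int k * int (c_max d c)"
      by (rule mult_right_mono) (auto simp: r)
    then show ?thesis using best_gain_diff_ge[OF k, of c] True by linarith
  next
    case False
    show ?thesis
    proof (rule ccontr)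
      assume "\<not> ?thesis"
      \<comment> \<open>Strict inequality of integers leaves room for \<open>l - 1\<close>, so the
        best size for \<open>l - 1\<close> can be taken as some \<open>m \<le> r\<close>. Reusing
        \<open>m\<close> for \<open>l\<close> shows that the objective at \<open>l\<close> exceeds
        that at \<open>l - 1\<close> by at least \<open>k - m \<ge> 1\<close>.\<close>
      then have small: "?V (Suc r) - ?V r \<le> l - 1" by simp
      obtain n where n: "size_attainable \<Delta> d n" "cover \<Delta> c (l - 1) d = ?V n - (l - 1) * int n"
        using cover_eq_best_gain[OF \<Delta>] by blast
      have "\<exists>m\<le>r. size_attainable \<Delta> d m \<and> cover \<Delta> c (l - 1) d \<le> ?V m - (l - 1) * int m"
      proof (cases "n \<le> r")
        case False
        then show ?thesis
          using best_gain_le_right[OF small n(1)] n(2) size_attainable_antimono[OF k, of r] by auto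
      qed (use n in auto)
      then obtain m where m: "m \<le> r" "size_attainable \<Delta> d m"
        "cover \<Delta> c (l - 1) d \<le> ?V m - (l - 1) * int m" by blast
      have "?V m - l * int m \<le> cover \<Delta> c l d" by (rule cover_ge_best_gain[OF \<Delta> m(2)])
      with m left False show False by (simp add: r algebra_simps)
    qed
  qed
  have upper: "?V (Suc k) - ?V k \<le> l" if a: "size_attainable \<Delta> d (Suc k)"
  proof (cases "l = int (c_max d c)")
    case True
    then show ?thesis using best_gain_diff_le[OF \<Delta> a] by simp
  next
    case False
    show ?thesis
    proof (rule ccontr)
      assume "\<not> ?thesis"
      \<comment> \<open>Symmetrically, some \<open>m > k\<close> is best for \<open>l + 1\<close>,
        and the objective at \<open>l\<close> exceeds that at \<open>l + 1\<close> by at least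
        \<open>m - k\<close>.\<close>
      then have large: "l + 1 \<le> ?V (Suc k) - ?V k" by simp
      obtain n where n: "size_attainable \<Delta> d n" "cover \<Delta> c (l + 1) d = ?V n - (l + 1) * int n"
        using cover_eq_best_gain[OF \<Delta>] by blast
      have "\<exists>m\<ge>Suc k. size_attainable \<Delta> d m \<and> cover \<Delta> c (l + 1) d \<le> ?V m - (l + 1) * int m"
      proof (cases "n \<le> Suc k")
        case True
        then show ?thesis
          using best_gain_le_left[OF large a] n(2) a by auto
      qed (use n in \<open>auto intro!: exI[of _ n]\<close>)
      then obtain m where m: "m \<ge> Suc k" "size_attainable \<Delta> d m"
        "cover \<Delta> c (l + 1) d \<le> ?V m - (l + 1) * int m" by blast
      have "?V m - l * int m \<le> cover \<Delta> c l d" by (rule cover_ge_best_gain[OF \<Delta> m(2)])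
      with m right False show False by (simp add: algebra_simps)
    qed
  qed
  have best: "?V n - l * int n \<le> ?V k - l * int k" if n: "size_attainable \<Delta> d n" for n
  proof (cases "n \<le> k")
    case True
    then show ?thesis using best_gain_le_left[OF lower k] by (simp add: r)
  next
    case False
    then have "size_attainable \<Delta> d (Suc k)" using size_attainable_antimono[OF n] by simp
    from best_gain_le_right[OF upper[OF this] n] False show ?thesis by simp
  qed
  obtain n where n: "size_attainable \<Delta> d n" "cover \<Delta> c l d = ?V n - l * int n"
    using cover_eq_best_gain[OF \<Delta>] by blast
  have obj: "int k * l + cover \<Delta> c l d \<le> ?V k"
    using best[OF n(1)] n(2) by (simp add: algebra_simps)
  obtain U where U: "profile \<Delta> U" "U d = int k" "gain d c U = ?V k"
    using k unfolding r by (rule best_gain_attained)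
  show ?thesis unfolding dual_optimal_def
  proof (intro conjI allI impI)
    fix v assume v: "dual_feasible \<Delta> d c v"
    have "real_of_int (?V k) \<le> dual_objective d k v"
      using gain_le_objective[OF U(1) v \<Delta>] U by (simp add: dual_objective_def mult.commute)
    then show "dual_objective d k (cover_point \<Delta> c l) \<le> dual_objective d k v"
      using obj unfolding cover_point_objective by linarith
  qed (rule cover_point_feasible[OF \<Delta>])
qed

section \<open>Weakest preconditions with running time\<close>

text \<open>Total correctness: the existential demands a halting run that is never stuck, and since
  \<open>exec\<close> is deterministic it concerns the only run. The time is passed to the
  postcondition, so that results and costs are proved together.\<close>

definition wp :: "int \<Rightarrow> com \<Rightarrow> state \<Rightarrow> (nat \<Rightarrow> state \<Rightarrow> bool) \<Rightarrow> bool" where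
  "wp M p s Q \<longleftrightarrow> (\<exists>t s'. exec M p s t s' \<and> Q t s')"

lemma wp_Skip: "Q 1 s \<Longrightarrow> wp M Skip s Q"
  unfolding wp_def using exec.Skip by blast

lemma wp_Assign:
  "aval M s a = Some v \<Longrightarrow> Q (1 + acost a) (s\<lparr>vars := (vars s)(x := v)\<rparr>) \<Longrightarrow> wp M (Assign x a) s Q"
  unfolding wp_def using exec.Assign by blast

lemma wp_Store:
  "aval M s a = Some i \<Longrightarrow> 0 \<le> i \<Longrightarrow> aval M s b = Some v \<Longrightarrow>
   Q (1 + acost a + acost b) (s\<lparr>arrs := (arrs s)(x := (arrs s x)(i := v))\<rparr>) \<Longrightarrow>
   wp M (Store x a b) s Q"
  unfolding wp_def using exec.Store by blast

lemma wp_Seq: "wp M p s (\<lambda>t s'. wp M q s' (\<lambda>u. Q (t + u))) \<Longrightarrow> wp M (Seq p q) s Q"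
  unfolding wp_def using exec.Seq by blast

lemma wp_Cond:
  assumes "bval M s b = Some v"
    and "v \<Longrightarrow> wp M p s (\<lambda>t. Q (1 + bcost b + t))" "\<not> v \<Longrightarrow> wp M q s (\<lambda>t. Q (1 + bcost b + t))"
  shows "wp M (Cond b p q) s Q"
proof (cases v)
  case True
  then have "bval M s b = Some True" "wp M p s (\<lambda>t. Q (1 + bcost b + t))" using assms by auto
  then show ?thesis unfolding wp_def by (blast intro: CondTrue)
next
  case False
  then have "bval M s b = Some False" "wp M q s (\<lambda>t. Q (1 + bcost b + t))" using assms by auto
  then show ?thesis unfolding wp_def by (blast intro: CondFalse)
qed

lemma wp_mono: "wp M p s Q \<Longrightarrow> (\<And>t s'. Q t s' \<Longrightarrow> R t s') \<Longrightarrow> wp M p s R"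
  unfolding wp_def by blast

text \<open>The index of \<open>I\<close> is an upper bound on the iterations still to come;
  \<open>T\<close> bounds the cost of one loop body.\<close>

lemma wp_While:
  assumes inv: "I n s"
    and step: "\<And>n s. I n s \<Longrightarrow> \<exists>v. bval M s b = Some v \<and>
      (if v then \<exists>m. n = Suc m \<and> wp M p s (\<lambda>t s'. t \<le> T \<and> I m s') else R s)"
  shows "wp M (While b p) s (\<lambda>t s'. t \<le> n * (1 + bcost b + T) + (1 + bcost b) \<and> R s')"
  using inv
proof (induction n arbitrary: s)
  case 0
  from step[OF 0] have "bval M s b = Some False" "R s" by (auto split: if_splits)
  then show ?case unfolding wp_def
    by (intro exI[of _ "1 + bcost b"] exI[of _ s] conjI WhileFalse) auto
next
  case (Suc n)
  from step[OF Suc.prems] obtain v where v: "bval M s b = Some v"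
    "if v then wp M p s (\<lambda>t s'. t \<le> T \<and> I n s') else R s" by (auto split: if_splits)
  show ?case
  proof (cases v)
    case True
    with v obtain t s' where p: "exec M p s t s'" "t \<le> T" "I n s'" by (auto simp: wp_def)
    from Suc.IH[OF p(3)] obtain u s'' where w: "exec M (While b p) s' u s''"
      "u \<le> n * (1 + bcost b + T) + (1 + bcost b)" "R s''" by (auto simp: wp_def)
    have "exec M (While b p) s (1 + bcost b + t + u) s''"
      using v True p w by (intro WhileTrue) auto
    moreover have "1 + bcost b + t + u \<le> Suc n * (1 + bcost b + T) + (1 + bcost b)"
      using p w by simp
    ultimately show ?thesis using w unfolding wp_def by blast
  next
    case False
    with v show ?thesis unfolding wp_def
      by (intro exI[of _ "1 + bcost b"] exI[of _ s] conjI WhileFalse) auto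
  qed
qed

abbreviation for_i :: "com \<Rightarrow> com" where
  "for_i p \<equiv> Seq (Assign ''i'' (N 1))
     (While (Less (V ''i'') (Plus (V ''d'') (N 1)))
       (Seq p (Assign ''i'' (Plus (V ''i'') (N 1)))))"

section \<open>The program\<close>

definition max_prog :: com where
  "max_prog = for_i (Cond (Less (V ''m'') (Elem ''c'' (V ''i''))) (Assign ''m'' (Elem ''c'' (V ''i''))) Skip)"

text \<open>Clamping \<open>j\<close> at 0 imitates truncated subtraction. The array
  \<open>x\<close> is overwritten in increasing order, so a run reads only its own entries and the
  one at 0, which is never written and keeps its initial value 0.\<close>

definition cover_prog :: com where
  "cover_prog = for_i
     (Seq (Assign ''j'' (Minus (V ''i'') (V ''Delta'')))
     (Seq (Cond (Less (V ''j'') (N 0)) (Assign ''j'' (N 0)) Skip)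
     (Seq (Assign ''v'' (Plus (Minus (Elem ''c'' (V ''i'')) (V ''l'')) (Elem ''x'' (V ''j''))))
     (Seq (Cond (Less (V ''v'') (Elem ''x'' (Minus (V ''i'') (N 1))))
            (Assign ''v'' (Elem ''x'' (Minus (V ''i'') (N 1)))) Skip)
       (Store ''x'' (V ''i'') (V ''v''))))))"

text \<open>Compares the objective at two neighbouring integers. Their common part
  \<open>k l\<close> cancels, which leaves the summand \<open>k\<close> on one side. Since
  \<open>l\<close> has been incremented, \<open>l - 1\<close> is the midpoint again.\<close>

definition search_prog :: com where
  "search_prog = While (Less (V ''lo'') (V ''hi''))
     (Seq (Assign ''l'' (Quot (Plus (V ''lo'') (V ''hi'')) (N 2)))
     (Seq cover_prog
     (Seq (Assign ''y'' (Elem ''x'' (V ''d'')))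
     (Seq (Assign ''l'' (Plus (V ''l'') (N 1)))
     (Seq cover_prog
       (Cond (Less (Plus (V ''k'') (Elem ''x'' (V ''d''))) (V ''y''))
         (Assign ''lo'' (V ''l''))
         (Assign ''hi'' (Minus (V ''l'') (N 1)))))))))"

definition output_prog :: com where
  "output_prog = Seq (Store ''w'' (N 0) (V ''lo''))
     (for_i (Store ''w'' (V ''i'') (Minus (Elem ''x'' (V ''i'')) (Elem ''x'' (Minus (V ''i'') (N 1))))))"

text \<open>\<open>cover_prog\<close> runs once more after the search because \<open>x\<close> holds
  the sums for the last \<open>l\<close> tested, which need not be the final
  \<open>lo\<close>.\<close>

definition dual_prog :: com where
  "dual_prog = Seq max_prog
     (Seq (Assign ''lo'' (Minus (N 0) (Times (V ''k'') (V ''m''))))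
     (Seq (Assign ''hi'' (V ''m''))
     (Seq search_prog
     (Seq (Assign ''l'' (V ''lo''))
     (Seq cover_prog output_prog)))))"

section \<open>Verification\<close>

text \<open>\<open>I\<close> is indexed by the next loop index, whereas \<open>wp_While\<close>
  counts down; the two add up to \<open>d + 1\<close>. Test and increment cost 6 + 4 per round,
  initialisation and the last test 2 + 6.\<close>

lemma wp_for_i:
  assumes M: "int d + 1 \<le> M" and d: "vars s ''d'' = int d"
    and start: "I 1 (s\<lparr>vars := (vars s)(''i'' := 1)\<rparr>)"
    and body: "\<And>n s. 1 \<le> n \<Longrightarrow> n \<le> d \<Longrightarrow> I n s \<Longrightarrow> vars s ''i'' = int n \<Longrightarrow> vars s ''d'' = int d \<Longrightarrow>
      wp M p s (\<lambda>t s'. t \<le> T \<and> vars s' ''i'' = int n \<and> vars s' ''d'' = int d \<and>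
        I (Suc n) (s'\<lparr>vars := (vars s')(''i'' := int n + 1)\<rparr>))"
  shows "wp M (for_i p) s (\<lambda>t s'. t \<le> d * (T + 10) + 8 \<and> I (Suc d) s')"
proof -
  let ?J = "\<lambda>r s. \<exists>n. 1 \<le> n \<and> n + r = Suc d \<and> I n s \<and> vars s ''i'' = int n \<and> vars s ''d'' = int d"
  let ?b = "Less (V ''i'') (Plus (V ''d'') (N 1))"
  let ?p = "Seq p (Assign ''i'' (Plus (V ''i'') (N 1)))"
  have M1: "\<bar>1\<bar> \<le> M" "\<bar>int d + 1\<bar> \<le> M" using M by auto
  have "wp M (While ?b ?p) (s\<lparr>vars := (vars s)(''i'' := 1)\<rparr>)
      (\<lambda>t s'. t \<le> d * (1 + bcost ?b + (T + 4)) + (1 + bcost ?b) \<and> I (Suc d) s')"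
  proof (rule wp_While[where I = ?J])
    show "?J d (s\<lparr>vars := (vars s)(''i'' := 1)\<rparr>)"
      using start d by (intro exI[of _ 1]) simp
  next
    fix r s assume "?J r s"
    then obtain n where n: "1 \<le> n" "n + r = Suc d" "I n s" "vars s ''i'' = int n" "vars s ''d'' = int d"
      by blast
    show "\<exists>v. bval M s ?b = Some v \<and>
      (if v then \<exists>m. r = Suc m \<and> wp M ?p s (\<lambda>t s'. t \<le> T + 4 \<and> ?J m s') else I (Suc d) s)"
    proof (cases "n \<le> d")
      case True
      then obtain m where m: "r = Suc m" using n by (cases r) auto
      have "wp M ?p s (\<lambda>t s'. t \<le> T + 4 \<and> ?J m s')"
      proof (rule wp_Seq, rule wp_mono[OF body[OF n(1) True n(3-5)]], elim conjE)
        fix t s' assume s': "t \<le> T" "vars s' ''i'' = int n" "vars s' ''d'' = int d"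
          "I (Suc n) (s'\<lparr>vars := (vars s')(''i'' := int n + 1)\<rparr>)"
        have "\<bar>int n + 1\<bar> \<le> M" using True M by simp
        then show "wp M (Assign ''i'' (Plus (V ''i'') (N 1))) s' (\<lambda>u s'. t + u \<le> T + 4 \<and> ?J m s')"
          using s' M1 n(2) m
          by (intro wp_Assign[where v = "int n + 1"] conjI exI[of _ "Suc n"]) (auto simp: word_def)
      qed
      moreover have "bval M s ?b = Some True" using True n M1 by (simp add: word_def)
      ultimately show ?thesis using m by auto
    next
      case False
      then have "n = Suc d" using n by simp
      then have "bval M s ?b = Some False" using n M1 by (simp add: word_def)
      then show ?thesis using n \<open>n = Suc d\<close> by auto
    qed
  qed
  then have "wp M (While ?b ?p) (s\<lparr>vars := (vars s)(''i'' := 1)\<rparr>)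
      (\<lambda>t s'. 2 + t \<le> d * (T + 10) + 8 \<and> I (Suc d) s')"
    by (rule wp_mono) (auto simp: algebra_simps)
  then show ?thesis using M1
    by (intro wp_Seq wp_Assign[where v = 1]) (simp_all add: word_def)
qed

section \<open>The two subroutines\<close>

lemma max_prog_wp:
  assumes M: "int d + 1 \<le> M" and "1 \<le> d" and vars: "vars s ''d'' = int d" "vars s ''m'' = 0"
    and c: "\<forall>i\<in>{1..d}. arrs s ''c'' (int i) = int (c i)"
  shows "wp M max_prog s (\<lambda>t s'. t \<le> 30 * d \<and> vars s' ''m'' = int (c_max d c) \<and>
    arrs s' = arrs s \<and> (\<forall>x. x \<notin> {''i'', ''m''} \<longrightarrow> vars s' x = vars s x))"
proof -
  \<comment> \<open>The inserted 0 covers the empty range and is the initial value of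
    \<open>m\<close>.\<close>
  define mx where "mx n = Max (insert 0 (c ` {1..<n}))" for n
  let ?I = "\<lambda>n s'. vars s' ''m'' = int (mx n) \<and>
    arrs s' = arrs s \<and> (\<forall>x. x \<notin> {''i'', ''m''} \<longrightarrow> vars s' x = vars s x)"
  have main: "wp M max_prog s (\<lambda>t s'. t \<le> d * (10 + 10) + 8 \<and> ?I (Suc d) s')"
    unfolding max_prog_def
  proof (rule wp_for_i[OF M vars(1)])
    show "?I 1 (s\<lparr>vars := (vars s)(''i'' := 1)\<rparr>)" using vars by (simp add: mx_def)
  next
    fix n :: nat and s' :: state
    assume n: "1 \<le> n" "n \<le> d" and I: "?I n s'"
      and i: "vars s' ''i'' = int n" "vars s' ''d'' = int d"
    have "mx (Suc n) = max (c n) (mx n)"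
    proof -
      have "insert 0 (c ` {1..<Suc n}) = insert (c n) (insert 0 (c ` {1..<n}))"
        using n by (auto simp: less_Suc_eq)
      then show ?thesis unfolding mx_def by (simp only:) (subst Max_insert; simp)
    qed
    moreover have "arrs s ''c'' (int n) = int (c n)" using c n by simp
    ultimately show "wp M (Cond (Less (V ''m'') (Elem ''c'' (V ''i''))) (Assign ''m'' (Elem ''c'' (V ''i''))) Skip) s'
      (\<lambda>t s'. t \<le> 10 \<and> vars s' ''i'' = int n \<and> vars s' ''d'' = int d \<and>
        ?I (Suc n) (s'\<lparr>vars := (vars s')(''i'' := int n + 1)\<rparr>))"
      using n I i
      by (intro wp_Cond[where v = "vars s' ''m'' < int (c n)"] wp_Assign[where v = "int (c n)"] wp_Skip)
        (auto simp: max_def)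
  qed
  have "mx (Suc d) = c_max d c"
  proof -
    have "Max (insert 0 (c ` {1..<Suc d})) = max 0 (Max (c ` {1..<Suc d}))"
      using \<open>1 \<le> d\<close> by (subst Max_insert) auto
    then show ?thesis unfolding c_max_def mx_def by (simp add: atLeastLessThanSuc_atLeastAtMost)
  qed
  with main \<open>1 \<le> d\<close> show ?thesis by (elim wp_mono) auto
qed

text \<open>\<open>W\<close> bounds the numbers \<open>c i - l\<close>, so by
  \<open>cover_le\<close> all partial sums are at most \<open>d W\<close>, and a further summand
  still fits into a word.\<close>

lemma cover_prog_computes:
  assumes M: "2 * (int d + 1) * (W + 1) + int \<Delta> \<le> M" and "1 \<le> \<Delta>"
    and vars: "vars s ''d'' = int d" "vars s ''Delta'' = int \<Delta>" "vars s ''l'' = l"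
    and c: "\<forall>i\<in>{1..d}. arrs s ''c'' (int i) = int (c i)"
    and x0: "arrs s ''x'' 0 = 0"
    and W: "\<forall>i\<in>{1..d}. \<bar>int (c i) - l\<bar> \<le> W" "0 \<le> W"
  shows "wp M cover_prog s (\<lambda>t s'. t \<le> d * 60 + 8 \<and>
    (\<forall>i\<le>d. arrs s' ''x'' (int i) = cover \<Delta> c l i) \<and>
    (\<forall>a. a \<noteq> ''x'' \<longrightarrow> arrs s' a = arrs s a) \<and>
    (\<forall>x. x \<notin> {''i'', ''j'', ''v''} \<longrightarrow> vars s' x = vars s x))"
proof -
  let ?I = "\<lambda>n s'. (\<forall>i<n. arrs s' ''x'' (int i) = cover \<Delta> c l i) \<and>
    (\<forall>a. a \<noteq> ''x'' \<longrightarrow> arrs s' a = arrs s a) \<and>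
    (\<forall>x. x \<notin> {''i'', ''j'', ''v''} \<longrightarrow> vars s' x = vars s x)"
  have dW: "0 \<le> int d * W" using W by simp
  have M': "2 * (int d * W) + 2 * int d + 2 * W + 2 + int \<Delta> \<le> M"
    using M by (simp add: algebra_simps)
  have "wp M cover_prog s (\<lambda>t s'. t \<le> d * (50 + 10) + 8 \<and> ?I (Suc d) s')"
    unfolding cover_prog_def
  proof (rule wp_for_i[OF _ vars(1)])
    show "int d + 1 \<le> M" using M' dW W by linarith
  next
    show "?I 1 (s\<lparr>vars := (vars s)(''i'' := 1)\<rparr>)" using x0 by simp
  next
    fix n :: nat and s' :: state
    assume n: "1 \<le> n" "n \<le> d" and I: "?I n s'"
      and i: "vars s' ''i'' = int n" "vars s' ''d'' = int d"
    have cl: "int (c j) - l \<le> W" if "j \<in> {1..m}" "m \<le> d" for j m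
      using W(1)[rule_format, of j] that by simp
    have bound: "0 \<le> cover \<Delta> c l m \<and> cover \<Delta> c l m \<le> int d * W" if "m \<le> d" for m
    proof -
      have "cover \<Delta> c l m \<le> int m * W" by (rule cover_le) (use cl that W in auto)
      also have "\<dots> \<le> int d * W" using that W by (intro mult_right_mono) auto
      finally show ?thesis using cover_nonneg[of \<Delta> c l m] by simp
    qed
    have c': "arrs s ''c'' (int n) = int (c n)" using c n by simp
    have vars': "vars s' ''Delta'' = int \<Delta>" "vars s' ''l'' = l" using I vars by auto
    have x: "arrs s' ''x'' (int j) = cover \<Delta> c l j" if "j < n" for j using I that by simp
    have x1: "arrs s' ''x'' (int n - 1) = cover \<Delta> c l (n - 1)"
      using x[of "n - 1"] n by (simp add: of_nat_diff)
    define j where "j = n - \<Delta>"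
    have j: "(if int n - int \<Delta> < 0 then 0 else int n - int \<Delta>) = int j" "j < n" "j \<le> d"
      using n \<open>1 \<le> \<Delta>\<close> by (auto simp: j_def)
    have xj: "arrs s' ''x'' (int j) = cover \<Delta> c l j" using x j by simp
    have step: "cover \<Delta> c l n = max (cover \<Delta> c l (n - 1)) (int (c n) - l + cover \<Delta> c l j)"
    proof -
      obtain m where m: "n = Suc m" using n by (cases n) auto
      have "m - (\<Delta> - 1) = j" using \<open>1 \<le> \<Delta>\<close> by (simp add: j_def m)
      then show ?thesis by (simp add: m)
    qed
    have words: "\<bar>int n - int \<Delta>\<bar> \<le> M" "\<bar>int n - 1\<bar> \<le> M" "\<bar>0\<bar> \<le> M" "\<bar>1\<bar> \<le> M"
      "\<bar>int (c n) - l\<bar> \<le> M" "\<bar>int (c n) - l + cover \<Delta> c l j\<bar> \<le> M"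
      using M' dW W(2) n W(1)[rule_format, of n] bound[OF j(3)] by auto
    have upd: "\<forall>i<Suc n. ((arrs s' ''x'')(int n := cover \<Delta> c l n)) (int i) = cover \<Delta> c l i"
      using x by (auto simp: less_Suc_eq)
    show "wp M
     (Seq (Assign ''j'' (Minus (V ''i'') (V ''Delta'')))
     (Seq (Cond (Less (V ''j'') (N 0)) (Assign ''j'' (N 0)) Skip)
     (Seq (Assign ''v'' (Plus (Minus (Elem ''c'' (V ''i'')) (V ''l'')) (Elem ''x'' (V ''j''))))
     (Seq (Cond (Less (V ''v'') (Elem ''x'' (Minus (V ''i'') (N 1))))
            (Assign ''v'' (Elem ''x'' (Minus (V ''i'') (N 1)))) Skip)
       (Store ''x'' (V ''i'') (V ''v'')))))) s'
      (\<lambda>t s'. t \<le> 50 \<and> vars s' ''i'' = int n \<and> vars s' ''d'' = int d \<and>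
        ?I (Suc n) (s'\<lparr>vars := (vars s')(''i'' := int n + 1)\<rparr>))"
      apply (rule wp_Seq, rule wp_Assign[where v = "int n - int \<Delta>"])
      subgoal using words i vars' by (simp add: word_def)
      \<comment> \<open>Both branches of the conditional are merged into one final state, so the
        rest is treated only once.\<close>
      apply (rule wp_Seq, rule wp_mono[where Q = "\<lambda>t s''. t \<le> 10 \<and> s'' = s'\<lparr>vars := (vars s')(''j'' := int j)\<rparr>"])
      subgoal
        using words j(1)
        by (intro wp_Cond[where v = "int n - int \<Delta> < 0"] wp_Assign[where v = 0] wp_Skip)
          (auto simp: word_def split: if_splits)
      apply (elim conjE, hypsubst)
      apply (rule wp_Seq, rule wp_Assign[where v = "int (c n) - l + cover \<Delta> c l j"])
      subgoal using words i vars' I c' xj by (simp add: word_def)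
      apply (rule wp_Seq, rule wp_mono[where Q = "\<lambda>t s''. t \<le> 20 \<and>
        s'' = s'\<lparr>vars := (vars s')(''j'' := int j, ''v'' := cover \<Delta> c l n)\<rparr>"])
      subgoal
        using words n i x1 step
        by (intro wp_Cond[where v = "int (c n) - l + cover \<Delta> c l j < cover \<Delta> c l (n - 1)"]
            wp_Assign[where v = "cover \<Delta> c l (n - 1)"] wp_Skip)
          (auto simp: word_def max_def)
      apply (elim conjE, hypsubst)
      apply (rule wp_Store[where i = "int n" and v = "cover \<Delta> c l n"])
      using I i upd by auto
  qed
  then show ?thesis by (rule wp_mono) auto
qed

definition holds_input :: "nat \<Rightarrow> nat \<Rightarrow> nat \<Rightarrow> (nat \<Rightarrow> nat) \<Rightarrow> state \<Rightarrow> bool" where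
  "holds_input \<Delta> d k c s \<longleftrightarrow>
     vars s ''d'' = int d \<and> vars s ''Delta'' = int \<Delta> \<and> vars s ''k'' = int k \<and>
     (\<forall>i\<in>{1..d}. arrs s ''c'' (int i) = int (c i)) \<and> arrs s ''x'' 0 = 0"

text \<open>For \<open>l\<close> in the search interval, \<open>c_max (1 + k)\<close> serves as
  \<open>W\<close> in \<open>cover_prog_computes\<close>; the last summand \<open>k\<close> is for
  the sum formed in the test of the bisection.\<close>

definition word_room :: "nat \<Rightarrow> nat \<Rightarrow> nat \<Rightarrow> (nat \<Rightarrow> nat) \<Rightarrow> int \<Rightarrow> bool" where
  "word_room \<Delta> d k c M \<longleftrightarrow>
     2 * (int d + 1) * (int (c_max d c) * (1 + int k) + 1) + int \<Delta> + int k \<le> M"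

lemma cover_prog_wp:
  assumes M: "word_room \<Delta> d k c M" and "1 \<le> \<Delta>" and s: "holds_input \<Delta> d k c s" "vars s ''l'' = l"
    and l: "- (int k * int (c_max d c)) \<le> l" "l \<le> int (c_max d c)"
  shows "wp M cover_prog s (\<lambda>t s'. t \<le> d * 60 + 8 \<and> holds_input \<Delta> d k c s' \<and>
    (\<forall>i\<le>d. arrs s' ''x'' (int i) = cover \<Delta> c l i) \<and>
    (\<forall>x. x \<notin> {''i'', ''j'', ''v''} \<longrightarrow> vars s' x = vars s x))"
proof (rule wp_mono[OF cover_prog_computes[where W = "int (c_max d c) * (1 + int k)"]])
  show "\<forall>i\<in>{1..d}. \<bar>int (c i) - l\<bar> \<le> int (c_max d c) * (1 + int k)"
  proof
    fix i assume "i \<in> {1..d}"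
    then have "int (c i) \<le> int (c_max d c)" using c_le_c_max[of i d c] by simp
    moreover have "0 \<le> int k * int (c_max d c)" by simp
    ultimately show "\<bar>int (c i) - l\<bar> \<le> int (c_max d c) * (1 + int k)"
      using l unfolding distrib_left mult_1_right mult.commute[of "int (c_max d c)"] by linarith
  qed
qed (use assms in \<open>auto simp: holds_input_def word_room_def\<close>)

lemma word_room_bounds:
  assumes "word_room \<Delta> d k c M"
  shows "2 * int (c_max d c) + 2 * (int k * int (c_max d c)) + 2 \<le> M" "int d + 1 \<le> M"
    "int k + int d * (int (c_max d c) * (1 + int k)) \<le> M"
proof -
  define W where "W = int (c_max d c) * (1 + int k)"
  have W: "0 \<le> W" by (simp add: W_def)
  then have dW: "0 \<le> int d * W" by simp
  have M: "2 * (int d * W) + 2 * int d + 2 * W + 2 + int \<Delta> + int k \<le> M"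
    using assms unfolding word_room_def W_def[symmetric] by (simp add: algebra_simps)
  show "int d + 1 \<le> M" "int k + int d * (int (c_max d c) * (1 + int k)) \<le> M"
    using M W dW unfolding W_def[symmetric] by linarith+
  have "W = int (c_max d c) + int k * int (c_max d c)" by (simp add: W_def algebra_simps)
  then show "2 * int (c_max d c) + 2 * (int k * int (c_max d c)) + 2 \<le> M"
    using M dW by linarith
qed

section \<open>The bisection\<close>

text \<open>\<open>lo\<close> is compared with its left and \<open>hi\<close> with its right
  neighbour only; for \<open>lo = hi\<close> this is what \<open>local_min_optimal\<close> asks
  for.\<close>

definition search_inv :: "nat \<Rightarrow> nat \<Rightarrow> nat \<Rightarrow> (nat \<Rightarrow> nat) \<Rightarrow> int \<Rightarrow> int \<Rightarrow> bool" where
  "search_inv \<Delta> d k c lo hi \<longleftrightarrow>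
     - (int k * int (c_max d c)) \<le> lo \<and> lo \<le> hi \<and> hi \<le> int (c_max d c) \<and>
     (lo = - (int k * int (c_max d c)) \<or>
      int k * lo + cover \<Delta> c lo d \<le> int k * (lo - 1) + cover \<Delta> c (lo - 1) d) \<and>
     (hi = int (c_max d c) \<or>
      int k * hi + cover \<Delta> c hi d \<le> int k * (hi + 1) + cover \<Delta> c (hi + 1) d)"

text \<open>Each round halves the interval, so \<open>n\<close> rounds suffice. A round makes two
  calls of \<open>cover_prog\<close> and constantly many further steps, which \<open>200 * d\<close>
  covers as \<open>d\<close> is positive.\<close>

lemma search_prog_wp:
  assumes M: "word_room \<Delta> d k c M" and "1 \<le> \<Delta>" "1 \<le> d" and s: "holds_input \<Delta> d k c s"
    and inv: "search_inv \<Delta> d k c (vars s ''lo'') (vars s ''hi'')"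
    and n: "vars s ''hi'' - vars s ''lo'' < 2 ^ n"
  shows "wp M search_prog s (\<lambda>t s'. t \<le> n * (4 + 200 * d) + 4 \<and> holds_input \<Delta> d k c s' \<and>
    search_inv \<Delta> d k c (vars s' ''lo'') (vars s' ''lo''))"
proof -
  let ?J = "\<lambda>n s. holds_input \<Delta> d k c s \<and> search_inv \<Delta> d k c (vars s ''lo'') (vars s ''hi'') \<and>
    vars s ''hi'' - vars s ''lo'' < 2 ^ n"
  let ?R = "\<lambda>s'. holds_input \<Delta> d k c s' \<and> search_inv \<Delta> d k c (vars s' ''lo'') (vars s' ''lo'')"
  let ?b = "Less (V ''lo'') (V ''hi'')"
  have "wp M search_prog s (\<lambda>t s'. t \<le> n * (1 + bcost ?b + 200 * d) + (1 + bcost ?b) \<and> ?R s')"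
    unfolding search_prog_def
  proof (rule wp_While[where I = ?J])
    show "?J n s" using assms by blast
  next
    fix n s assume J: "?J n s"
    define lo hi where "lo = vars s ''lo''" and "hi = vars s ''hi''"
    have inv: "search_inv \<Delta> d k c lo hi" and s: "holds_input \<Delta> d k c s" and n: "hi - lo < 2 ^ n"
      using J by (auto simp: lo_def hi_def)
    let ?p = "Seq (Assign ''l'' (Quot (Plus (V ''lo'') (V ''hi'')) (N 2)))
     (Seq cover_prog
     (Seq (Assign ''y'' (Elem ''x'' (V ''d'')))
     (Seq (Assign ''l'' (Plus (V ''l'') (N 1)))
     (Seq cover_prog
       (Cond (Less (Plus (V ''k'') (Elem ''x'' (V ''d''))) (V ''y''))
         (Assign ''lo'' (V ''l''))
         (Assign ''hi'' (Minus (V ''l'') (N 1))))))))"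
    show "\<exists>v. bval M s ?b = Some v \<and>
      (if v then \<exists>m. n = Suc m \<and> wp M ?p s (\<lambda>t s'. t \<le> 200 * d \<and> ?J m s') else ?R s)"
    proof (cases "lo < hi")
      case False
      then have "lo = hi" using inv by (simp add: search_inv_def)
      then show ?thesis using J False by (intro exI[of _ False]) (simp add: lo_def hi_def)
    next
      case True
      define mid where "mid = (lo + hi) div 2"
      have mid: "lo \<le> mid" "mid < hi" using True by (auto simp: mid_def)
      obtain m where m: "n = Suc m" using n True by (cases n) auto
      have half: "mid - lo < 2 ^ m" "hi - (mid + 1) < 2 ^ m"
        using n True by (auto simp: mid_def m)
      have range: "- (int k * int (c_max d c)) \<le> lo" "hi \<le> int (c_max d c)"
        using inv by (auto simp: search_inv_def)
      have kc: "0 \<le> int k * int (c_max d c)" "0 \<le> int (c_max d c)" by auto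
      note room = word_room_bounds[OF M]
      have words: "\<bar>lo + hi\<bar> \<le> M" "\<bar>2\<bar> \<le> M" "\<bar>1\<bar> \<le> M" "\<bar>mid\<bar> \<le> M" "\<bar>mid + 1\<bar> \<le> M"
        using room(1) range mid kc True by linarith+
      have "cover \<Delta> c (mid + 1) d \<le> int d * (int (c_max d c) * (1 + int k))"
      proof (rule cover_le)
        fix j assume "j \<in> {1..d}"
        then have "int (c j) \<le> int (c_max d c)" using c_le_c_max[of j d c] by simp
        then show "int (c j) - (mid + 1) \<le> int (c_max d c) * (1 + int k)"
          using range mid by (simp add: algebra_simps)
      qed simp
      then have word_k: "\<bar>int k + cover \<Delta> c (mid + 1) d\<bar> \<le> M"
        using room(3) cover_nonneg[of \<Delta> c "mid + 1" d] by linarith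
      define y where "y = cover \<Delta> c mid d"
      define z where "z = cover \<Delta> c (mid + 1) d"
      \<comment> \<open>The test says that the objective drops from \<open>mid\<close> to
        \<open>mid + 1\<close>, which is the left comparison for the new \<open>lo\<close>; its
        failure is the right comparison for \<open>hi = mid\<close>.\<close>
      have next1: "search_inv \<Delta> d k c (mid + 1) hi" if "int k + z < y"
        using inv mid that by (auto simp: search_inv_def y_def z_def algebra_simps)
      have next2: "search_inv \<Delta> d k c lo mid" if "\<not> int k + z < y"
        using inv mid that by (auto simp: search_inv_def y_def z_def algebra_simps)
      have "wp M ?p s (\<lambda>t s'. t \<le> 200 * d \<and> ?J m s')"
      proof (rule wp_Seq, rule wp_Assign[where v = mid])
        show "aval M s (Quot (Plus (V ''lo'') (V ''hi'')) (N 2)) = Some mid"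
          using words by (simp add: word_def mid_def lo_def hi_def)
        show "wp M (Seq cover_prog
           (Seq (Assign ''y'' (Elem ''x'' (V ''d'')))
           (Seq (Assign ''l'' (Plus (V ''l'') (N 1)))
           (Seq cover_prog
             (Cond (Less (Plus (V ''k'') (Elem ''x'' (V ''d''))) (V ''y''))
               (Assign ''lo'' (V ''l''))
               (Assign ''hi'' (Minus (V ''l'') (N 1))))))))
           (s\<lparr>vars := (vars s)(''l'' := mid)\<rparr>)
           (\<lambda>u s'. 1 + acost (Quot (Plus (V ''lo'') (V ''hi'')) (N 2)) + u \<le> 200 * d \<and> ?J m s')"
        proof (rule wp_Seq, rule wp_mono[OF cover_prog_wp[OF M \<open>1 \<le> \<Delta>\<close>, where l = mid]], goal_cases)
          case (5 t1 s1)
          then have s1: "holds_input \<Delta> d k c s1" "arrs s1 ''x'' (int d) = y"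
            "vars s1 ''l'' = mid" "vars s1 ''lo'' = lo" "vars s1 ''hi'' = hi" "vars s1 ''d'' = int d"
            and t1: "t1 \<le> d * 60 + 8"
            using s by (auto simp: y_def lo_def hi_def holds_input_def)
          show ?case
          proof (rule wp_Seq, rule wp_Assign[where v = y], goal_cases)
            case 2
            show ?case
            proof (rule wp_Seq, rule wp_Assign[where v = "mid + 1"], goal_cases)
              case 2
              show ?case
              proof (rule wp_Seq, rule wp_mono[OF cover_prog_wp[OF M \<open>1 \<le> \<Delta>\<close>, where l = "mid + 1"]], goal_cases)
                case (5 t2 s2)
                then have s2: "holds_input \<Delta> d k c s2" "arrs s2 ''x'' (int d) = z" "vars s2 ''y'' = y"
                  "vars s2 ''l'' = mid + 1" "vars s2 ''lo'' = lo" "vars s2 ''hi'' = hi" "vars s2 ''d'' = int d"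
                  "vars s2 ''k'' = int k"
                  and t2: "t2 \<le> d * 60 + 8"
                  using s1 by (auto simp: z_def holds_input_def)
                show ?case
                proof (rule wp_Cond[where v = "int k + z < y"], goal_cases)
                  case 1
                  then show ?case using s2 word_k by (simp add: word_def z_def)
                next
                  case 2
                  then show ?case
                    using s2 t1 t2 next1 half \<open>1 \<le> d\<close>
                    by (intro wp_Assign[where v = "mid + 1"]) (auto simp: holds_input_def)
                next
                  case 3
                  then show ?case
                    using s2 t1 t2 next2 half \<open>1 \<le> d\<close> words
                    by (intro wp_Assign[where v = "mid"]) (auto simp: holds_input_def word_def)
                qed
              qed (use s1 mid range in \<open>auto simp: holds_input_def\<close>)
            qed (use s1 words in \<open>auto simp: word_def\<close>)
          qed (use s1 in auto)
        qed (use s mid range in \<open>auto simp: holds_input_def\<close>)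
      qed
      then show ?thesis using m True by (auto simp: lo_def hi_def)
    qed
  qed
  then show ?thesis by (rule wp_mono) (auto simp: algebra_simps)
qed

lemma output_prog_wp:
  assumes M: "int d + 1 \<le> M" and vars: "vars s ''d'' = int d" "vars s ''lo'' = l"
    and x: "\<forall>i\<le>d. arrs s ''x'' (int i) = cover \<Delta> c l i"
    and word: "\<forall>i\<in>{1..d}. \<bar>cover \<Delta> c l i - cover \<Delta> c l (i - 1)\<bar> \<le> M"
  shows "wp M output_prog s (\<lambda>t s'. t \<le> d * 30 + 11 \<and> (\<forall>i\<le>d. output_point s' i = cover_point \<Delta> c l i))"
proof -
  let ?I = "\<lambda>n s'. (\<forall>i<n. output_point s' i = cover_point \<Delta> c l i) \<and> arrs s' ''x'' = arrs s ''x''"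
  let ?e = "Minus (Elem ''x'' (V ''i'')) (Elem ''x'' (Minus (V ''i'') (N 1)))"
  let ?s = "s\<lparr>arrs := (arrs s)(''w'' := (arrs s ''w'')(0 := l))\<rparr>"
  have "wp M (for_i (Store ''w'' (V ''i'') ?e)) ?s (\<lambda>t s'. t \<le> d * (20 + 10) + 8 \<and> ?I (Suc d) s')"
  proof (rule wp_for_i[OF M])
    show "vars ?s ''d'' = int d" using vars by simp
    show "?I 1 (?s\<lparr>vars := (vars ?s)(''i'' := 1)\<rparr>)"
      by (simp add: output_point_def cover_point_def)
  next
    fix n :: nat and s' :: state
    assume n: "1 \<le> n" "n \<le> d" and I: "?I n s'"
      and i: "vars s' ''i'' = int n" "vars s' ''d'' = int d"
    have "arrs s' ''x'' (int n - 1) = cover \<Delta> c l (n - 1)"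
      using x[rule_format, of "n - 1"] n I by (simp add: of_nat_diff)
    moreover have "arrs s' ''x'' (int n) = cover \<Delta> c l n" using x n I by simp
    moreover have "\<bar>cover \<Delta> c l n - cover \<Delta> c l (n - 1)\<bar> \<le> M" using word n by simp
    ultimately show "wp M (Store ''w'' (V ''i'') ?e) s'
      (\<lambda>t s'. t \<le> 20 \<and> vars s' ''i'' = int n \<and> vars s' ''d'' = int d \<and>
        ?I (Suc n) (s'\<lparr>vars := (vars s')(''i'' := int n + 1)\<rparr>))"
      using n I i M
      by (intro wp_Store[where i = "int n" and v = "cover \<Delta> c l n - cover \<Delta> c l (n - 1)"])
        (auto simp: word_def output_point_def cover_point_def less_Suc_eq)
  qed
  then have "wp M (for_i (Store ''w'' (V ''i'') ?e)) ?s
      (\<lambda>t s'. 3 + t \<le> d * 30 + 11 \<and> (\<forall>i\<le>d. output_point s' i = cover_point \<Delta> c l i))"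
    by (rule wp_mono) auto
  then show ?thesis unfolding output_prog_def using M vars
    by (intro wp_Seq[of _ "Store _ _ _"] wp_Store[where i = 0 and v = l]) (simp_all add: word_def)
qed

lemma search_inv_cover_le:
  assumes "search_inv \<Delta> d k c l l" "m \<le> d"
  shows "cover \<Delta> c l m \<le> int d * (int (c_max d c) * (1 + int k))"
proof -
  have "cover \<Delta> c l d \<le> int d * (int (c_max d c) * (1 + int k))"
  proof (rule cover_le)
    fix j assume "j \<in> {1..d}"
    then have "int (c j) \<le> int (c_max d c)" using c_le_c_max[of j d c] by simp
    then show "int (c j) - l \<le> int (c_max d c) * (1 + int k)"
      using assms by (simp add: search_inv_def algebra_simps)
  qed simp
  then show ?thesis using cover_mono[OF assms(2), of \<Delta> c l] by linarith
qed

text \<open>\<open>c_max (1 + k)\<close> is the width of the initial interval, whose ends satisfy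
  the invariant by being the ends.\<close>

lemma dual_prog_wp:
  assumes M: "word_room \<Delta> d k c M" and "1 \<le> \<Delta>" "1 \<le> d"
    and n: "int (c_max d c) * (1 + int k) < 2 ^ n"
  shows "wp M dual_prog (input_state \<Delta> d k c) (\<lambda>t s. t \<le> n * (4 + 200 * d) + 200 * d \<and>
    (\<exists>l. search_inv \<Delta> d k c l l \<and> (\<forall>i\<le>d. output_point s i = cover_point \<Delta> c l i)))"
  unfolding dual_prog_def
proof (rule wp_Seq, rule wp_mono[OF max_prog_wp[where c = c and d = d]], goal_cases)
  case (6 t1 s1)
  let ?m = "int (c_max d c)"
  note room = word_room_bounds[OF M]
  have kc: "0 \<le> int k * ?m" "0 \<le> ?m" by auto
  have words: "\<bar>int k * ?m\<bar> \<le> M" "\<bar>0 - int k * ?m\<bar> \<le> M" "\<bar>0\<bar> \<le> M"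
    using room(1) kc by linarith+
  have s1: "holds_input \<Delta> d k c s1" "vars s1 ''m'' = ?m" and t1: "t1 \<le> 30 * d"
    using 6 by (auto simp: holds_input_def input_state_def)
  show ?case
  proof (rule wp_Seq, rule wp_Assign[where v = "- (int k * ?m)"], goal_cases)
    case 1
    show ?case using s1 words by (simp add: word_def holds_input_def)
  next
    case 2
    show ?case
    proof (rule wp_Seq, rule wp_Assign[where v = ?m], goal_cases)
      case 1
      show ?case using s1 by simp
    next
      case 2
      show ?case
      proof (rule wp_Seq, rule wp_mono[OF search_prog_wp[OF M \<open>1 \<le> \<Delta>\<close> \<open>1 \<le> d\<close>, where n = n]], goal_cases)
        case 1
        show ?case using s1 by (simp add: holds_input_def)
      next
        case 2
        have "- (int k * ?m) \<le> ?m" using kc by linarith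
        then show ?case by (simp add: search_inv_def)
      next
        case 3
        show ?case using n by (simp add: algebra_simps)
      next
        case (4 t2 s2)
        define l where "l = vars s2 ''lo''"
        have s2: "holds_input \<Delta> d k c s2" "search_inv \<Delta> d k c l l" and t2: "t2 \<le> n * (4 + 200 * d) + 4"
          using 4 by (auto simp: l_def)
        show ?case
        proof (rule wp_Seq, rule wp_Assign[where v = l], goal_cases)
          case 1
          show ?case by (simp add: l_def)
        next
          case 2
          show ?case
          proof (rule wp_Seq, rule wp_mono[OF cover_prog_wp[OF M \<open>1 \<le> \<Delta>\<close>, where l = l]], goal_cases)
            case (5 t3 s3)
            then have s3: "vars s3 ''d'' = int d" "vars s3 ''lo'' = l"
              "\<forall>i\<le>d. arrs s3 ''x'' (int i) = cover \<Delta> c l i" and t3: "t3 \<le> d * 60 + 8"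
              by (auto simp: holds_input_def l_def)
            show ?case
            proof (rule wp_mono[OF output_prog_wp[OF room(2) s3]], goal_cases)
              case 1
              show ?case
              proof
                fix i assume "i \<in> {1..d}"
                then have "cover \<Delta> c l i \<le> int d * (int (c_max d c) * (1 + int k))"
                  using search_inv_cover_le[OF s2(2)] by simp
                then show "\<bar>cover \<Delta> c l i - cover \<Delta> c l (i - 1)\<bar> \<le> M"
                  using room(3) cover_nonneg[of \<Delta> c l "i - 1"] cover_mono[of "i - 1" i \<Delta> c l] by linarith
              qed
            next
              case (2 t4 s4)
              then show ?case using t1 t2 t3 s2 \<open>1 \<le> d\<close> by auto
            qed
          qed (use s2 in \<open>auto simp: holds_input_def search_inv_def\<close>)
        qed
      qed
    qed
  qed
qed (use assms word_room_bounds[OF M] in \<open>auto simp: input_state_def\<close>)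

section \<open>Word size, number of bisection steps and conclusion\<close>

text \<open>Needed because the output is known to agree with the greedy solution up to index
  \<open>d\<close> only.\<close>

lemma dual_optimal_cong:
  assumes "\<And>i. i \<le> d \<Longrightarrow> v i = w i"
  shows "dual_optimal \<Delta> d c k v \<longleftrightarrow> dual_optimal \<Delta> d c k w"
proof -
  have "(\<Sum>j | 1 \<le> j \<and> j \<le> i \<and> i \<le> j + \<Delta> - 1. v j) = (\<Sum>j | 1 \<le> j \<and> j \<le> i \<and> i \<le> j + \<Delta> - 1. w j)"
    if "i \<in> {1..d}" for i
    using assms that by (intro sum.cong) auto
  then have "dual_feasible \<Delta> d c v \<longleftrightarrow> dual_feasible \<Delta> d c w"
    unfolding dual_feasible_def using assms by simp
  moreover have "dual_objective d k v = dual_objective d k w"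
    unfolding dual_objective_def using assms by simp
  ultimately show ?thesis unfolding dual_optimal_def by simp
qed

lemma word_room_word_bound:
  assumes "1 \<le> \<Delta>" "1 \<le> d" "1 \<le> k"
  shows "word_room \<Delta> d k c (word_bound 4 \<Delta> d k c)"
proof -
  define m where "m = c_max d c"
  define B where "B = d + k + m + \<Delta>"
  \<comment> \<open>This is what turns the bound 3 B^3, reached below, into B^4 and explains the
    exponent 4.\<close>
  have B: "3 \<le> B" using assms by (simp add: B_def)
  have "m * (1 + k) + 1 \<le> B * B"
  proof -
    have "m * (1 + k) + 1 \<le> m * B + B"
      using B assms by (intro add_mono mult_left_mono) (auto simp: B_def)
    also have "\<dots> = (m + 1) * B" by simp
    also have "\<dots> \<le> B * B" using assms by (intro mult_right_mono) (auto simp: B_def)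
    finally show ?thesis .
  qed
  then have "2 * (d + 1) * (m * (1 + k) + 1) \<le> 2 * B * (B * B)"
    using assms by (intro mult_mono) (auto simp: B_def)
  moreover have "\<Delta> + k \<le> B" by (simp add: B_def)
  moreover have "B \<le> B * (B * B)" using B by simp
  ultimately have "2 * (d + 1) * (m * (1 + k) + 1) + \<Delta> + k \<le> 3 * (B * (B * B))" by linarith
  also have "\<dots> \<le> B * (B * (B * B))" using B by (intro mult_right_mono) auto
  also have "\<dots> = B ^ 4" by (simp add: power4_eq_xxxx)
  finally have "2 * (d + 1) * (m * (1 + k) + 1) + \<Delta> + k \<le> B ^ 4" .
  then have "int (2 * (d + 1) * (m * (1 + k) + 1) + \<Delta> + k) \<le> int (B ^ 4)"
    by (simp only: of_nat_le_iff)
  then show ?thesis unfolding word_room_def word_bound_def B_def m_def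
    by (simp add: algebra_simps)
qed

text \<open>The interval width is at most \<open>2 m k\<close>, so its binary length is at most 2 +
  log m + log k; the factor 2 absorbs the extra 1. For \<open>m = 0\<close> the interval is a single
  point.\<close>

lemma search_depth:
  assumes "1 \<le> k"
  obtains n where "int m * (1 + int k) < 2 ^ n"
    "real n \<le> 2 * (1 + log 2 (real (max 1 m)) + log 2 (real k))"
proof (cases "m = 0")
  case True
  show ?thesis using assms by (intro that[of 0]) (simp_all add: True)
next
  case False
  define W where "W = m * (1 + k)"
  have W: "1 \<le> W" using False by (simp add: W_def)
  obtain n where n: "2 ^ n \<le> W" "W < 2 ^ (n + 1)"
    using ex_power_ivl1[of 2 W] W by auto
  have "W \<le> 2 * m * k" using assms by (simp add: W_def)
  then have "2 ^ n \<le> 2 * m * k" using n by linarith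
  then have "real (2 ^ n) \<le> real (2 * m * k)" by (simp only: of_nat_le_iff)
  then have le: "2 ^ n \<le> 2 * real m * real k" by simp
  have "real n = log 2 (2 ^ n)" by simp
  also have "\<dots> \<le> log 2 (2 * real m * real k)"
    using le False assms by (subst log_le_cancel_iff) auto
  also have "\<dots> = 1 + log 2 (real m) + log 2 (real k)"
    using False assms by (simp add: log_mult)
  finally have "real (n + 1) \<le> 2 + log 2 (real m) + log 2 (real k)" by simp
  moreover have "0 \<le> log 2 (real m)" "0 \<le> log 2 (real k)" using False assms by auto
  moreover have "x \<le> 2 + a + b \<Longrightarrow> 0 \<le> a \<Longrightarrow> 0 \<le> b \<Longrightarrow> x \<le> 2 * (1 + a + b)" for x a b :: real
    by simp
  ultimately have "real (n + 1) \<le> 2 * (1 + log 2 (real m) + log 2 (real k))" by blast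
  moreover have "max 1 m = m" using False by simp
  ultimately have "real (n + 1) \<le> 2 * (1 + log 2 (real (max 1 m)) + log 2 (real k))" by simp
  moreover have "int m * (1 + int k) < 2 ^ (n + 1)"
  proof -
    have "int W < int (2 ^ (n + 1))" using n(2) by (simp only: of_nat_less_iff)
    then show ?thesis by (simp add: W_def distrib_left)
  qed
  ultimately show ?thesis by (intro that)
qed

theorem theorem9:
  "\<exists>(prog :: com) (C :: real) (e :: nat).
     \<forall>(\<Delta> :: nat) (d :: nat) (k :: nat) (c :: nat \<Rightarrow> nat).
       \<Delta> \<ge> 1 \<longrightarrow> d \<ge> 1 \<longrightarrow> k \<ge> 1 \<longrightarrow>
       (\<exists>t s. exec (word_bound e \<Delta> d k c) prog (input_state \<Delta> d k c) t s \<and>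
              real t \<le> C * time_bound d k c \<and>
              ((\<exists>w. dual_optimal \<Delta> d c k w) \<longrightarrow> dual_optimal \<Delta> d c k (output_point s)))"
proof (rule exI[of _ dual_prog], rule exI[of _ 608], rule exI[of _ 4], intro allI impI)
  fix \<Delta> d k :: nat and c :: "nat \<Rightarrow> nat"
  assume pos: "\<Delta> \<ge> 1" "d \<ge> 1" "k \<ge> 1"
  define L where "L = 1 + log 2 (real (max 1 (c_max d c))) + log 2 (real k)"
  have L: "1 \<le> L" using pos by (simp add: L_def)
  obtain n where n: "int (c_max d c) * (1 + int k) < 2 ^ n" "real n \<le> 2 * L"
    unfolding L_def using search_depth[OF pos(3)] by blast
  obtain t s l where run: "exec (word_bound 4 \<Delta> d k c) dual_prog (input_state \<Delta> d k c) t s"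
    and t: "t \<le> n * (4 + 200 * d) + 200 * d" and l: "search_inv \<Delta> d k c l l"
    and out: "\<forall>i\<le>d. output_point s i = cover_point \<Delta> c l i"
    using dual_prog_wp[OF word_room_word_bound[OF pos, of c] pos(1,2) n(1)] unfolding wp_def by blast
  have "n * (4 + 200 * d) + 200 * d \<le> n * (204 * d) + 200 * d"
    using pos by (intro add_mono mult_left_mono) auto
  with t have "real t \<le> real (n * (204 * d) + 200 * d)" by linarith
  also have "\<dots> = real d * (204 * real n + 200)" by (simp add: algebra_simps)
  \<comment> \<open>608 = 204 * 2 + 200, from \<open>n \<le> 2 L\<close> and
    \<open>1 \<le> L\<close>.\<close>
  also have "\<dots> \<le> real d * (608 * L)"
    using n(2) L by (intro mult_left_mono) auto
  finally have time: "real t \<le> 608 * time_bound d k c"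
    by (simp add: time_bound_def L_def algebra_simps)
  \<comment> \<open>Only here is an optimal solution assumed to exist; halting, word size and time
    hold for every input.\<close>
  have "dual_optimal \<Delta> d c k (output_point s)" if "dual_optimal \<Delta> d c k w" for w
  proof -
    have "dual_optimal \<Delta> d c k (cover_point \<Delta> c l)"
      by (rule local_min_optimal[OF pos(1,3) that]) (use l in \<open>auto simp: search_inv_def\<close>)
    then show ?thesis using out dual_optimal_cong[of d "output_point s" "cover_point \<Delta> c l"] by blast
  qed
  with run time show "\<exists>t s. exec (word_bound 4 \<Delta> d k c) dual_prog (input_state \<Delta> d k c) t s \<and>
      real t \<le> 608 * time_bound d k c \<and>
      ((\<exists>w. dual_optimal \<Delta> d c k w) \<longrightarrow> dual_optimal \<Delta> d c k (output_point s))"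
    by blast
qed

end
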